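(* For every integer $n\geq3$, the group $H_n=\langle a_n,\tilde b_n\rangle\le\operatorname{Aut}X^*$ has Hausdorff dimension equal to $1$.
   Context: Let $X=\{0,1\}$; $X^*$, the set of finite words over $X$, is identified with the vertex set of the infinite binary rooted tree, and $\operatorname{Aut}X^*$ is the automorphism group of that rooted tree. Every $g\in\operatorname{Aut}X^*$ is written $g=\ll g@0,g@1\gg\tau$ with $g@x\in\operatorname{Aut}X^*$ and $\tau\in\operatorname{Sym}(X)$; it sends $xw$ to the letter $\tau(x)$ followed by the image of $w$ under $g@x$ ($\tau$ is omitted if trivial). For $G\le\operatorname{Aut}X^*$, $\operatorname{Stab}_G(m)$ is the subgroup of elements fixing every vertex of $X^m$, $(G\bmod m)=G/\operatorname{Stab}_G(m)$, and the Hausdorff dimension of $G$ is $\dim_HG=\liminf_{m\to\infty}\frac{\log_2|G\bmod m|}{2^m}$. Let $a_1=\sigma$ be the automorphism exchanging the two maximal subtrees ($xw\mapsto(1-x)w$), and for $n\ge2$ let $a_n=\ll1,a_{n-1}\gg\sigma$. Write $a=a_1$. For $g\in\operatorname{Aut}X^*$ and $w\in X^*$, let $w*g$ be the automorphism acting as $g$ on the subtree $wX^*$ (i.e. $wu\mapsto w\,g(u)$) and trivially everywhere else. For $g_1,\dots,g_n\in\operatorname{Aut}X^*$ put $$\delta(g_1,\dots,g_n)=\prod_{i=0}^{n-1}(1^i0^{n-i})*g_{i+1}$$ (the factors commute). For $m\ge1$ define $b_{(1,m)},\dots,b_{(m,m)}\in\operatorname{Aut}X^*$ by $b_{(i,m)}=\ll1,b_{(i+1,m)}\gg$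 for $1\le i\le m-1$ and $b_{(m,m)}=\ll a,b_{(1,m)}\gg$. For $n\ge3$ define, by simultaneous recursion on the levels of the tree, $$\tilde b_n=\delta(a,b_{(1,n-3)},\dots,b_{(n-3,n-3)},a_{n+1},\tilde b_{n+1}),$$ where $\delta$ has $n$ arguments (for $n=3$, $\tilde b_3=\delta(a,a_4,\tilde b_4)$). *)

theory Defs
  imports
    "HOL-Algebra.Generated_Groups"
    "HOL-Library.Extended_Real"
    "HOL-Library.Sublist"
begin

text \<open>The alphabet \<open>X = {0,1}\<close> is \<open>bool\<close>, with \<open>0 = False\<close> and \<open>1 = True\<close>.\<close>

type_synonym word = "bool list"

section \<open>The automorphism group of the rooted binary tree\<close>

definition tree_adj :: "word \<Rightarrow> word \<Rightarrow> bool" where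
  "tree_adj u v \<longleftrightarrow> (\<exists>x. v = u @ [x]) \<or> (\<exists>x. u = v @ [x])"

definition tree_aut :: "(word \<Rightarrow> word) set" where
  "tree_aut = {f. bij f \<and> f [] = [] \<and> (\<forall>u v. tree_adj (f u) (f v) \<longleftrightarrow> tree_adj u v)}"

definition AutX :: "(word \<Rightarrow> word) monoid" where
  "AutX = \<lparr>carrier = tree_aut, mult = (\<circ>), one = id\<rparr>"

definition level_stab :: "(word \<Rightarrow> word) set \<Rightarrow> nat \<Rightarrow> (word \<Rightarrow> word) set" where
  "level_stab G m = {g \<in> G. \<forall>v. length v = m \<longrightarrow> g v = v}"

definition mod_level :: "(word \<Rightarrow> word) set \<Rightarrow> nat \<Rightarrow> (word \<Rightarrow> word) set monoid" where
  "mod_level G m = (AutX\<lparr>carrier := G\<rparr>) Mod (level_stab G m)"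

definition hausdorff_dim :: "(word \<Rightarrow> word) set \<Rightarrow> ereal" where
  "hausdorff_dim G = liminf (\<lambda>m. ereal (log 2 (real (order (mod_level G m))) / 2 ^ m))"

section \<open>Wreath recursion and \<open>\<delta>\<close>\<close>

text \<open>\<open>node g0 g1 \<tau>\<close> is \<open>\<lless>g0, g1\<ggreater>\<tau>\<close>.\<close>

fun node :: "(word \<Rightarrow> word) \<Rightarrow> (word \<Rightarrow> word) \<Rightarrow> (bool \<Rightarrow> bool) \<Rightarrow> word \<Rightarrow> word" where
  "node g0 g1 \<tau> [] = []"
| "node g0 g1 \<tau> (x # w) = \<tau> x # (if x then g1 w else g0 w)"

text \<open>\<open>graft w g\<close> is \<open>w * g\<close>.\<close>

definition graft :: "word \<Rightarrow> (word \<Rightarrow> word) \<Rightarrow> word \<Rightarrow> word" where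
  "graft w g u = (if prefix w u then w @ g (drop (length w) u) else u)"

text \<open>The list argument \<open>gs\<close> is indexed from 0, so \<open>gs ! i\<close> is \<open>g\<^sub>i\<^sub>+\<^sub>1\<close>.\<close>

definition delta :: "(word \<Rightarrow> word) list \<Rightarrow> word \<Rightarrow> word" where
  "delta gs = foldr (\<circ>)
     (map (\<lambda>i. graft (replicate i True @ replicate (length gs - i) False) (gs ! i))
       [0..<length gs]) id"

section \<open>The generators\<close>

text \<open>The value of \<open>gen_a\<close> at 0 is a dummy.\<close>

fun gen_a :: "nat \<Rightarrow> word \<Rightarrow> word" where
  "gen_a 0 = id"
| "gen_a (Suc 0) = node id id Not"
| "gen_a (Suc (Suc n)) = node id (gen_a (Suc n)) Not"

text \<open>\<open>gen_b i m\<close> is \<open>b\<^bsub>(i,m)\<^esub>\<close>, meaningful for \<open>1 \<le> i \<le> m\<close>. The recursive system defining the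
  \<open>b\<^bsub>(i,m)\<^esub>\<close> is resolved by recursion on the word acted upon; see \<open>gen_b_less\<close> and \<open>gen_b_last\<close>.\<close>

fun gen_b :: "nat \<Rightarrow> nat \<Rightarrow> word \<Rightarrow> word" where
  "gen_b i m [] = []"
| "gen_b i m (False # w) = False # (if i < m then w else gen_a 1 w)"
| "gen_b i m (True # w) = True # gen_b (if i < m then Suc i else 1) m w"

text \<open>The \<open>n\<close> arguments of \<open>\<delta>\<close> in the recursion for \<open>b\<close>-tilde, with \<open>g\<close> in the last position.\<close>

definition bt_args :: "nat \<Rightarrow> (word \<Rightarrow> word) \<Rightarrow> (word \<Rightarrow> word) list" where
  "bt_args n g =
     [gen_a 1] @ map (\<lambda>i. gen_b i (n - 3)) [1..<Suc (n - 3)] @ [gen_a (n + 1), g]"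

text \<open>\<open>gen_bt_approx k n\<close> unfolds the recursion \<open>k\<close> times; since each unfolding moves at least one
  level down, it is the action of \<open>b\<close>-tilde on words of length at most \<open>k\<close>. The resulting
  \<open>gen_bt n\<close> satisfies the defining recursion (\<open>gen_bt_rec\<close>) and is its only
  solution in tree automorphisms (\<open>gen_bt_unique\<close>).\<close>

fun gen_bt_approx :: "nat \<Rightarrow> nat \<Rightarrow> word \<Rightarrow> word" where
  "gen_bt_approx 0 n = id"
| "gen_bt_approx (Suc k) n = delta (bt_args n (gen_bt_approx k (Suc n)))"

definition gen_bt :: "nat \<Rightarrow> word \<Rightarrow> word" where
  "gen_bt n w = gen_bt_approx (length w) n w"

definition H :: "nat \<Rightarrow> (word \<Rightarrow> word) set" where
  "H n = generate AutX {gen_a n, gen_bt n}"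

section \<open>Basic facts\<close>

lemma gen_b_less: "i < m \<Longrightarrow> gen_b i m = node id (gen_b (Suc i) m) id"
proof
  fix w assume "i < m"
  then show "gen_b i m w = node id (gen_b (Suc i) m) id w"
    by (cases "(i, m, w)" rule: gen_b.cases) auto
qed

lemma gen_b_last: "gen_b m m = node (gen_a 1) (gen_b 1 m) id"
proof
  fix w show "gen_b m m w = node (gen_a 1) (gen_b 1 m) id w"
    by (cases "(m, m, w)" rule: gen_b.cases) auto
qed

lemma length_bt_args: "n \<ge> 3 \<Longrightarrow> length (bt_args n g) = n"
  by (simp add: bt_args_def del: upt_Suc)

lemma tree_adj_Nil [simp]: "tree_adj [] v \<longleftrightarrow> length v = 1" "tree_adj v [] \<longleftrightarrow> length v = 1"
  by (auto simp: tree_adj_def length_Suc_conv)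

lemma tree_adj_Cons [simp]: "tree_adj (x # u) (y # v) \<longleftrightarrow> x = y \<and> tree_adj u v"
  by (auto simp: tree_adj_def Cons_eq_append_conv)

lemma tree_adj_length: "tree_adj u v \<Longrightarrow> length v = Suc (length u) \<or> length u = Suc (length v)"
  by (auto simp: tree_adj_def)

lemma tree_aut_length:
  assumes "f \<in> tree_aut"
  shows "length (f w) = length w"
proof (induction "length w" arbitrary: w rule: less_induct)
  case less
  have inj: "inj f" and nil: "f [] = []"
    and adj: "\<And>u v. tree_adj (f u) (f v) \<longleftrightarrow> tree_adj u v"
    using assms by (auto simp: tree_aut_def bij_def)
  show ?case
  proof (cases w rule: rev_cases)
    case Nil
    then show ?thesis by (simp add: nil)
  next
    case (snoc u x)
    have lu: "length (f u) = length u" using less snoc by simp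
    have a1: "tree_adj (f u) (f w)" using adj snoc by (auto simp: tree_adj_def)
    show ?thesis
    proof (rule ccontr)
      assume "length (f w) \<noteq> length w"
      with tree_adj_length[OF a1] lu snoc have len: "length (f u) = Suc (length (f w))" by simp
      with a1 obtain y where y: "f u = f w @ [y]" by (auto simp: tree_adj_def)
      have "u \<noteq> []" using len nil by auto
      then obtain t z where t: "u = t @ [z]" by (metis rev_exhaust)
      have lt: "length (f t) = length t" using less snoc t by simp
      have "tree_adj (f t) (f u)" using adj t by (auto simp: tree_adj_def)
      then have "\<exists>z'. f u = f t @ [z']" using lt lu t by (auto simp: tree_adj_def)
      with y have "f t = f w" by auto
      with inj have "t = w" by (auto dest: injD)
      then show False using t snoc by simp
    qed
  qed
qed

lemma tree_aut_id: "id \<in> tree_aut" by (simp add: tree_aut_def)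

lemma tree_aut_comp: "f \<in> tree_aut \<Longrightarrow> g \<in> tree_aut \<Longrightarrow> f \<circ> g \<in> tree_aut"
  by (auto simp: tree_aut_def bij_comp)

lemma tree_aut_inv:
  assumes "f \<in> tree_aut" shows "inv_into UNIV f \<in> tree_aut"
proof -
  have f: "bij f" "f [] = []" "\<And>u v. tree_adj (f u) (f v) \<longleftrightarrow> tree_adj u v"
    using assms by (auto simp: tree_aut_def)
  then have "\<And>u. f (inv_into UNIV f u) = u" by (simp add: bij_is_surj surj_f_inv_f)
  then show ?thesis
    unfolding tree_aut_def using f(2) f(3)[of "inv_into UNIV f u" "inv_into UNIV f v" for u v]
      bij_imp_bij_inv[OF f(1)] inv_f_f[OF bij_is_inj[OF f(1)], of "[]"] by simp
qed

lemma group_AutX: "group AutX"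
proof (rule groupI)
  fix f assume "f \<in> carrier AutX"
  then have f: "f \<in> tree_aut" by (simp add: AutX_def)
  then have "inv_into UNIV f \<circ> f = id" by (simp add: tree_aut_def bij_is_inj)
  then show "\<exists>g\<in>carrier AutX. g \<otimes>\<^bsub>AutX\<^esub> f = \<one>\<^bsub>AutX\<^esub>"
    using tree_aut_inv[OF f] by (auto simp: AutX_def intro!: bexI)
qed (auto simp: AutX_def tree_aut_id tree_aut_comp comp_assoc)

lemma tree_aut_node:
  assumes "g0 \<in> tree_aut" "g1 \<in> tree_aut" "bij \<tau>"
  shows "node g0 g1 \<tau> \<in> tree_aut"
proof -
  let ?f = "node g0 g1 \<tau>"
  have g: "bij g0" "bij g1" using assms by (auto simp: tree_aut_def)
  have "u = v" if "?f u = ?f v" for u v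
  proof -
    have "\<tau> x = \<tau> y \<longleftrightarrow> x = y" "g0 w = g0 z \<longleftrightarrow> w = z" "g1 w = g1 z \<longleftrightarrow> w = z" for x y w z
      using g assms(3) by (auto simp: bij_def inj_eq)
    then show ?thesis using that by (cases u; cases v) (simp_all split: if_splits)
  qed
  moreover have "\<exists>u. v = ?f u" for v
  proof (cases v)
    case Nil
    then show ?thesis by (intro exI[of _ "[]"]) simp
  next
    case (Cons y w)
    obtain x where x: "y = \<tau> x" using surjD[OF bij_is_surj[OF assms(3)]] by blast
    obtain u0 where u0: "w = g0 u0" using surjD[OF bij_is_surj[OF g(1)]] by blast
    obtain u1 where u1: "w = g1 u1" using surjD[OF bij_is_surj[OF g(2)]] by blast
    show ?thesis using Cons x u0 u1 by (intro exI[of _ "x # (if x then u1 else u0)"]) auto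
  qed
  ultimately have "bij ?f" by (auto simp: bij_def inj_def surj_def)
  moreover have len: "length (?f u) = length u" for u
    using assms tree_aut_length by (cases u) auto
  have adj: "tree_adj (?f u) (?f v) \<longleftrightarrow> tree_adj u v" for u v
  proof (cases "u = [] \<or> v = []")
    case True
    then show ?thesis by (auto simp: len)
  next
    case False
    then obtain x u' y v' where uv: "u = x # u'" "v = y # v'" by (meson list.exhaust)
    have "\<tau> x = \<tau> y \<longleftrightarrow> x = y" using assms(3) by (simp add: bij_def inj_eq)
    then show ?thesis using uv assms(1,2) by (auto simp: tree_aut_def)
  qed
  ultimately show ?thesis by (auto simp: tree_aut_def)
qed

lemma bij_Not: "bij Not"
  by (rule bijI') auto

lemma gen_a_aut: "gen_a n \<in> tree_aut"
  by (induction n rule: gen_a.induct) (simp_all only: gen_a.simps tree_aut_node tree_aut_id bij_Not)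

lemma tree_aut_local:
  assumes "\<And>w :: word. \<exists>g\<in>tree_aut. \<forall>u. length u \<le> length w \<longrightarrow> f u = g u"
  shows "f \<in> tree_aut"
proof -
  have common: "\<exists>g\<in>tree_aut. f u = g u \<and> f v = g v" for u v
  proof -
    obtain g where "g \<in> tree_aut" "\<forall>w. length w \<le> length (u @ v) \<longrightarrow> f w = g w"
      using assms by blast
    then show ?thesis by (intro bexI[of _ g]) auto
  qed
  have "u = v" if "f u = f v" for u v
    using common[of u v] that by (auto simp: tree_aut_def bij_def inj_eq)
  moreover have "\<exists>u. v = f u" for v
  proof -
    obtain g where g: "g \<in> tree_aut" "\<forall>u. length u \<le> length v \<longrightarrow> f u = g u"
      using assms by blast
    then have "surj g" by (simp add: tree_aut_def bij_is_surj)
    then obtain u where u: "v = g u" by (auto simp: surj_def)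
    with g tree_aut_length[OF g(1), of u] show ?thesis by (intro exI[of _ u]) simp
  qed
  ultimately have "bij f" by (auto simp: bij_def inj_def surj_def)
  moreover have "f [] = []" using common[of "[]" "[]"] by (auto simp: tree_aut_def)
  moreover have "tree_adj (f u) (f v) \<longleftrightarrow> tree_adj u v" for u v
    using common[of u v] by (auto simp: tree_aut_def)
  ultimately show ?thesis by (auto simp: tree_aut_def)
qed

lemma gen_b_aut: "gen_b i m \<in> tree_aut"
proof -
  have unfold: "gen_b i m = node (if i < m then id else gen_a 1)
      (gen_b (if i < m then Suc i else 1) m) id" for i
  proof
    fix w show "gen_b i m w = node (if i < m then id else gen_a 1)
      (gen_b (if i < m then Suc i else 1) m) id w"
      by (cases "(i, m, w)" rule: gen_b.cases) auto
  qed
  have approx: "\<exists>g\<in>tree_aut. \<forall>u. length u \<le> k \<longrightarrow> gen_b i m u = g u" for k i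
  proof (induction k arbitrary: i)
    case 0
    then show ?case by (intro bexI[OF _ tree_aut_id]) simp
  next
    case (Suc k)
    obtain g where g: "g \<in> tree_aut"
      "\<And>u. length u \<le> k \<Longrightarrow> gen_b (if i < m then Suc i else 1) m u = g u"
      using Suc by blast
    let ?h = "node (if i < m then id else gen_a 1) g id"
    have "gen_b i m u = ?h u" if "length u \<le> Suc k" for u
      using that g(2) by (subst unfold) (cases u; auto)
    moreover have "?h \<in> tree_aut"
      using g(1) by (cases "i < m") (simp_all only: if_True if_False tree_aut_node tree_aut_id gen_a_aut bij_id)
    ultimately show ?case by blast
  qed
  show ?thesis by (rule tree_aut_local) (rule approx)
qed

lemma graft_Nil: "graft [] g = g"
  by (auto simp: graft_def)

lemma graft_Cons:
  "graft (x # w) g = node (if x then id else graft w g) (if x then graft w g else id) id"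
proof
  fix u show "graft (x # w) g u = node (if x then id else graft w g) (if x then graft w g else id) id u"
    by (cases u) (auto simp: graft_def)
qed

lemma tree_aut_graft: "g \<in> tree_aut \<Longrightarrow> graft w g \<in> tree_aut"
  by (induction w) (auto simp: graft_Nil graft_Cons intro!: tree_aut_node tree_aut_id)

lemma tree_aut_foldr: "set fs \<subseteq> tree_aut \<Longrightarrow> foldr (\<circ>) fs id \<in> tree_aut"
  by (induction fs) (auto intro!: tree_aut_id tree_aut_comp)

lemma tree_aut_delta: "set gs \<subseteq> tree_aut \<Longrightarrow> delta gs \<in> tree_aut"
  unfolding delta_def by (rule tree_aut_foldr) (auto intro!: tree_aut_graft simp: subset_iff)

lemma tree_aut_bt_args: "g \<in> tree_aut \<Longrightarrow> set (bt_args n g) \<subseteq> tree_aut"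
  using gen_a_aut gen_b_aut by (auto simp: bt_args_def simp del: gen_a.simps One_nat_def)

lemma foldr_comp_cong:
  assumes "list_all2 (\<lambda>f g. \<forall>u. length u \<le> k \<longrightarrow> f u = g u) fs gs"
    and "set gs \<subseteq> tree_aut" and "length u \<le> k"
  shows "foldr (\<circ>) fs id u = foldr (\<circ>) gs id u"
  using assms
proof (induction fs gs arbitrary: u rule: list_all2_induct)
  case (Cons f fs g gs)
  have "length (foldr (\<circ>) gs id u) = length u"
    using Cons.prems by (intro tree_aut_length tree_aut_foldr) auto
  then have "f (foldr (\<circ>) gs id u) = g (foldr (\<circ>) gs id u)"
    using Cons.hyps(1) Cons.prems(2) by presburger
  moreover have "foldr (\<circ>) fs id u = foldr (\<circ>) gs id u"
    using Cons.prems by (intro Cons.IH) auto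
  moreover have "foldr (\<circ>) (h # hs) id u = h (foldr (\<circ>) hs id u)"
    for h :: "word \<Rightarrow> word" and hs by simp
  ultimately show ?case by (simp only:)
qed simp

text \<open>The last argument of \<open>\<delta>\<close> acts at least one level below the root.\<close>

lemma delta_bt_args_cong:
  assumes g: "g \<in> tree_aut" and eq: "\<And>u. length u \<le> k \<Longrightarrow> f u = g u"
    and "length w \<le> Suc k"
  shows "delta (bt_args n f) w = delta (bt_args n g) w"
proof -
  let ?L = "length (bt_args n g)"
  let ?v = "\<lambda>i. replicate i True @ replicate (?L - i) False"
  have L: "length (bt_args n f) = ?L" "?L \<ge> 1" by (auto simp: bt_args_def)
  have nth: "bt_args n f ! i = bt_args n g ! i \<or> bt_args n f ! i = f \<and> bt_args n g ! i = g"
    if "i < ?L" for i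
  proof -
    obtain P where P: "\<And>h. bt_args n h = P @ [h]" unfolding bt_args_def by simp
    show ?thesis using that unfolding P by (cases "i = length P") (simp_all add: nth_append)
  qed
  have "graft (?v i) (bt_args n f ! i) u = graft (?v i) (bt_args n g ! i) u"
    if "i < ?L" "length u \<le> Suc k" for i u
  proof -
    have "length (?v i) = ?L" using that(1) by simp
    then have "f (drop (length (?v i)) u) = g (drop (length (?v i)) u)"
      using that(2) L(2) by (intro eq) simp
    then have "graft (?v i) f u = graft (?v i) g u" by (simp add: graft_def)
    with nth[OF that(1)] show ?thesis by (elim disjE) simp_all
  qed
  moreover have "graft (?v i) (bt_args n g ! i) \<in> tree_aut" if "i < ?L" for i
    using tree_aut_bt_args[OF g, of n] nth_mem[OF that] by (intro tree_aut_graft) blast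
  ultimately show ?thesis
    unfolding delta_def L(1)
    by (intro foldr_comp_cong[OF _ _ assms(3)])
      (auto simp: list_all2_conv_all_nth)
qed

lemma gen_bt_approx_aut: "gen_bt_approx k n \<in> tree_aut"
  by (induction k arbitrary: n) (auto intro!: tree_aut_id tree_aut_delta tree_aut_bt_args)

lemma gen_bt_approx_stable:
  "length w \<le> k \<Longrightarrow> k \<le> l \<Longrightarrow> gen_bt_approx k n w = gen_bt_approx l n w"
proof (induction k arbitrary: l n w)
  case 0
  then have "gen_bt_approx l n [] = []" using gen_bt_approx_aut[of l n] by (simp add: tree_aut_def)
  then show ?case using 0 by simp
next
  case (Suc k)
  then obtain l' where l: "l = Suc l'" "k \<le> l'" by (auto simp: Suc_le_D dest: Suc_le_D)
  show ?case unfolding l gen_bt_approx.simps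
    by (rule delta_bt_args_cong[where k = k]) (use Suc l gen_bt_approx_aut in auto)
qed

lemma gen_bt_approx_eq: "length w \<le> k \<Longrightarrow> gen_bt n w = gen_bt_approx k n w"
  unfolding gen_bt_def by (rule gen_bt_approx_stable) auto

lemma gen_bt_aut: "gen_bt n \<in> tree_aut"
proof (rule tree_aut_local)
  fix w :: word
  show "\<exists>g\<in>tree_aut. \<forall>u. length u \<le> length w \<longrightarrow> gen_bt n u = g u"
    by (rule bexI[OF _ gen_bt_approx_aut[of "length w" n]]) (simp add: gen_bt_approx_eq[of _ "length w"])
qed

theorem gen_bt_rec: "gen_bt n = delta (bt_args n (gen_bt (Suc n)))"
proof
  fix w
  have "gen_bt n w = delta (bt_args n (gen_bt_approx (length w) (Suc n))) w"
    using gen_bt_approx_eq[of w "Suc (length w)" n] by simp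
  also have "\<dots> = delta (bt_args n (gen_bt (Suc n))) w"
    by (rule delta_bt_args_cong[OF gen_bt_aut, where k = "length w"])
      (auto simp: gen_bt_approx_eq[of _ "length w"])
  finally show "gen_bt n w = delta (bt_args n (gen_bt (Suc n))) w" .
qed

theorem gen_bt_unique:
  assumes "\<And>n. n \<ge> 3 \<Longrightarrow> c n \<in> tree_aut"
    and "\<And>n. n \<ge> 3 \<Longrightarrow> c n = delta (bt_args n (c (Suc n)))" and "n \<ge> 3"
  shows "c n = gen_bt n"
proof -
  have "c n w = gen_bt n w" if "length w \<le> k" "n \<ge> 3" for k n w
    using that
  proof (induction k arbitrary: n w)
    case 0
    then show ?case using assms(1)[of n] gen_bt_aut[of n] by (simp add: tree_aut_def)
  next
    case (Suc k)
    have "c n w = delta (bt_args n (c (Suc n))) w" by (simp only: assms(2)[OF Suc.prems(2)])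
    also have "\<dots> = delta (bt_args n (gen_bt (Suc n))) w"
      by (rule delta_bt_args_cong[OF gen_bt_aut, where k = k]) (use Suc in auto)
    finally show ?case by (simp only: gen_bt_rec[of n, symmetric])
  qed
  from this[OF order_refl assms(3)] show ?thesis by (rule ext)
qed

lemma H_subgroup: "subgroup (H n) AutX"
  unfolding H_def using gen_a_aut gen_bt_aut
  by (intro group.generate_is_subgroup[OF group_AutX]) (auto simp: AutX_def)

end

theory Submission
  imports Defs
begin

text \<open>
  The commutator of \<open>b\<close>-tilde with a suitable conjugate of itself under \<open>a\<^sub>n\<close> is supported below a
  single vertex of level \<open>n\<close>. Hence the derived subgroup of \<open>H n\<close> contains a copy of the derived subgroup
  of \<open>L\<close> at every vertex of level \<open>n\<close>, where \<open>L\<close> is generated by the arguments of \<open>\<delta>\<close>. This \<open>L\<close> contains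
  both \<open>H (n + 1)\<close> and the group \<open>GB (n - 3)\<close> generated by \<open>a\<close> and the \<open>b\<^bsub>(i,n-3)\<^esub>\<close>. Iterating, for every
  large \<open>m\<close> the group \<open>H n\<close> contains copies of the derived subgroup of \<open>GB m\<close> at all vertices of some level.
  That subgroup contains \<open>KB m\<close>, the normal closure in \<open>GB m\<close> of the commutators of \<open>a\<close> with \<open>b\<^bsub>(i,m)\<^esub>\<close>
  for \<open>i \<ge> 2\<close>, which is regular branch, so \<open>H n\<close> contains copies of \<open>KB m\<close> at all vertices of every deeper
  level. Since \<open>GB m\<close> is the full automorphism group on level \<open>m + 1\<close> and \<open>KB m\<close> has index at most
  \<open>2 ^ (m + 2)\<close> in it, the dimension is at least \<open>1 - (m + 3) / 2 ^ (m + 1)\<close>, for every large \<open>m\<close>.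
\<close>

section \<open>Groups of tree automorphisms\<close>

interpretation AutX: group AutX
  by (rule group_AutX)

lemma AutX_simps [simp]:
  "carrier AutX = tree_aut" "f \<otimes>\<^bsub>AutX\<^esub> g = f \<circ> g" "\<one>\<^bsub>AutX\<^esub> = id"
  by (simp_all add: AutX_def)

lemma tree_aut_inverse [simp]:
  assumes "f \<in> tree_aut"
  shows "inv\<^bsub>AutX\<^esub> f \<in> tree_aut" "f ((inv\<^bsub>AutX\<^esub> f) u) = u" "(inv\<^bsub>AutX\<^esub> f) (f u) = u"
  using assms AutX.inv_closed[of f] AutX.r_inv[of f] AutX.l_inv[of f]
  by (auto simp: fun_eq_iff)

lemma tree_aut_inv_eqI:
  assumes "f \<in> tree_aut" "g \<in> tree_aut" "\<And>u. f (g u) = u"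
  shows "inv\<^bsub>AutX\<^esub> g = f"
  using assms by (intro AutX.inv_equality) (auto simp: fun_eq_iff)

lemma inv_involution:
  assumes "f \<in> tree_aut" "\<And>u. f (f u) = u"
  shows "inv\<^bsub>AutX\<^esub> f = f"
  using tree_aut_inv_eqI assms by blast

lemma tree_aut_Nil: "f \<in> tree_aut \<Longrightarrow> f [] = []"
  by (simp add: tree_aut_def)

lemma tree_aut_snoc:
  assumes "f \<in> tree_aut"
  shows "\<exists>y. f (u @ [x]) = f u @ [y]"
proof -
  have "tree_adj (f u) (f (u @ [x]))"
    using assms by (auto simp: tree_aut_def tree_adj_def)
  moreover have "length (f (u @ [x])) = Suc (length (f u))"
    using tree_aut_length[OF assms] by simp
  ultimately show ?thesis by (auto simp: tree_adj_def)
qed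

lemma tree_aut_take:
  assumes "f \<in> tree_aut"
  shows "f (take k u) = take k (f u)"
proof (induction u rule: rev_induct)
  case Nil
  then show ?case by (simp add: tree_aut_Nil[OF assms])
next
  case (snoc x u)
  obtain y where "f (u @ [x]) = f u @ [y]" using tree_aut_snoc[OF assms] by blast
  with snoc show ?case
    using tree_aut_length[OF assms, of u] by (cases "k \<le> length u") simp_all
qed

lemma tree_aut_inj: "f \<in> tree_aut \<Longrightarrow> f u = f v \<longleftrightarrow> u = v"
  by (auto simp: tree_aut_def bij_def inj_eq)

text \<open>The root permutation is the first letter of \<open>f (x # u)\<close>, which depends on
  \<open>x\<close> alone since prefixes are preserved; the sections are the remaining
  letters.\<close>

lemma tree_aut_node_cases:
  assumes "f \<in> tree_aut"
  obtains f0 f1 \<tau> where "f0 \<in> tree_aut" "f1 \<in> tree_aut" "\<tau> \<in> {id, Not}" "f = node f0 f1 \<tau>"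
proof -
  note len = tree_aut_length[OF assms] and inj = tree_aut_inj[OF assms]
  define \<tau> where "\<tau> x = hd (f [x])" for x
  have hd: "hd (f (x # u)) = \<tau> x" for x u
    using tree_aut_take[OF assms, of 1 "x # u"] len[of "x # u"]
    by (cases "f (x # u)") (auto simp: \<tau>_def)
  define s where "s x u = tl (f (x # u))" for x u
  have f: "f (x # u) = \<tau> x # s x u" for x u
    using len[of "x # u"] hd[of x u] by (cases "f (x # u)") (auto simp: s_def)
  have "f [True] \<noteq> f [False]" using inj by simp
  moreover have "f [x] = [\<tau> x]" for x using f[of x "[]"] len[of "[x]"] by simp
  ultimately have neq: "\<tau> True \<noteq> \<tau> False" by metis
  have "\<tau> \<in> {id, Not}"
  proof (cases "\<tau> True")
    case True
    with neq have "\<tau> = id" by (intro ext) (metis (full_types) id_apply)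
    then show ?thesis by simp
  next
    case False
    with neq have "\<tau> = Not" by (intro ext) (metis (full_types))
    then show ?thesis by simp
  qed
  moreover have "s x \<in> tree_aut" for x
  proof -
    have adj: "tree_adj (s x u) (s x v) \<longleftrightarrow> tree_adj u v" for u v
    proof -
      have "tree_adj (f (x # u)) (f (x # v)) \<longleftrightarrow> tree_adj (x # u) (x # v)"
        using assms unfolding tree_aut_def by blast
      then show ?thesis by (simp add: f)
    qed
    have "inj (s x)"
      by (rule injI) (metis f inj list.inject)
    moreover have "\<exists>u. v = s x u" for v
    proof -
      have "surj f" using assms by (simp add: tree_aut_def bij_is_surj)
      then obtain w where w: "\<tau> x # v = f w" by (auto simp: surj_def)
      with len[of w] obtain y u where "w = y # u" by (cases w) auto
      with w f[of y u] have "\<tau> y = \<tau> x" "v = s y u" by auto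
      moreover have "y = x" using \<open>\<tau> y = \<tau> x\<close> neq by (cases x; cases y) auto
      ultimately show ?thesis by blast
    qed
    ultimately have "bij (s x)" by (auto simp: bij_def surj_def)
    moreover have "s x [] = []" using f[of x "[]"] len[of "[x]"] by simp
    ultimately show ?thesis using adj by (auto simp: tree_aut_def)
  qed
  moreover have "f = node (s False) (s True) \<tau>"
  proof
    fix u show "f u = node (s False) (s True) \<tau> u"
      by (cases u) (auto simp: f tree_aut_Nil[OF assms])
  qed
  ultimately show ?thesis using that by blast
qed

lemma subgroup_AutX_iff:
  "subgroup S AutX \<longleftrightarrow> S \<subseteq> tree_aut \<and> id \<in> S \<and> (\<forall>f\<in>S. \<forall>g\<in>S. f \<circ> g \<in> S) \<and> (\<forall>f\<in>S. inv\<^bsub>AutX\<^esub> f \<in> S)"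
  by (simp add: subgroup_def) blast

lemma subgroupD:
  assumes "subgroup S AutX"
  shows "\<And>f. f \<in> S \<Longrightarrow> f \<in> tree_aut" "id \<in> S" "\<And>f g. f \<in> S \<Longrightarrow> g \<in> S \<Longrightarrow> f \<circ> g \<in> S"
    "\<And>f. f \<in> S \<Longrightarrow> inv\<^bsub>AutX\<^esub> f \<in> S"
  using assms unfolding subgroup_AutX_iff by blast+

section \<open>Counting actions on a level\<close>

definition words :: "nat \<Rightarrow> word set" where
  "words k = {u. length u = k}"

text \<open>Counting restrictions instead of cosets also makes sense for sets that are not groups,
  such as the sets of nodes in the recursion over levels.\<close>

definition act_count :: "(word \<Rightarrow> word) set \<Rightarrow> nat \<Rightarrow> nat" where
  "act_count S k = card ((\<lambda>f. restrict f (words k)) ` S)"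

lemma finite_words: "finite (words k)"
  using finite_lists_length_eq[of "UNIV :: bool set" k] by (simp add: words_def)

lemma tree_aut_words: "f \<in> tree_aut \<Longrightarrow> f u \<in> words k \<longleftrightarrow> u \<in> words k"
  by (simp add: words_def tree_aut_length)

lemma finite_restrict_image:
  assumes "S \<subseteq> tree_aut"
  shows "finite ((\<lambda>f. restrict f (words k)) ` S)"
proof -
  have "(\<lambda>f. restrict f (words k)) ` S \<subseteq> (words k \<rightarrow>\<^sub>E words k)"
    using assms tree_aut_words by auto
  then show ?thesis by (rule finite_subset) (simp add: finite_PiE finite_words)
qed

lemma restrict_eq_iff: "restrict f A = restrict g A \<longleftrightarrow> (\<forall>u\<in>A. f u = g u)"
  by (auto simp: fun_eq_iff restrict_def)

lemma act_count_mono: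
  assumes "S \<subseteq> T" "T \<subseteq> tree_aut"
  shows "act_count S k \<le> act_count T k"
  unfolding act_count_def using assms by (intro card_mono finite_restrict_image image_mono)

lemma card_image_cong:
  assumes "\<And>x y. x \<in> A \<Longrightarrow> y \<in> A \<Longrightarrow> f x = f y \<longleftrightarrow> g x = g y"
  shows "card (f ` A) = card (g ` A)"
proof -
  define h where "h z = g (inv_into A f z)" for z
  have h: "h (f x) = g x" if "x \<in> A" for x
    using assms[of "inv_into A f (f x)" x] that unfolding h_def
    by (simp add: f_inv_into_f inv_into_into)
  have "inj_on h (f ` A)" using h assms by (auto simp: inj_on_def)
  moreover have "h ` f ` A = g ` A" using h by (force simp: image_iff)
  ultimately show ?thesis by (metis card_image)
qed

text \<open>A coset of the level stabilizer consists of exactly those elements of \<open>G\<close>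
  that share one action on the level, so cosets and actions are equally many.\<close>

lemma order_mod_level:
  assumes "subgroup G AutX"
  shows "order (mod_level G k) = act_count G k"
proof -
  let ?r = "\<lambda>f. restrict f (words k)"
  define C where "C g = {f \<in> G. ?r f = ?r g}" for g
  have coset: "level_stab G k #>\<^bsub>AutX\<lparr>carrier := G\<rparr>\<^esub> g = C g" if g: "g \<in> G" for g
  proof (intro equalityI subsetI)
    fix f assume "f \<in> level_stab G k #>\<^bsub>AutX\<lparr>carrier := G\<rparr>\<^esub> g"
    then obtain s where s: "s \<in> level_stab G k" "f = s \<circ> g"
      by (auto simp: r_coset_def)
    then have "f \<in> G" using assms g by (auto simp: level_stab_def subgroup_AutX_iff)
    moreover have "f u = g u" if "u \<in> words k" for u
      using that s tree_aut_words[of g u k] subgroupD(1)[OF assms g]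
      by (auto simp: level_stab_def words_def)
    ultimately show "f \<in> C g" by (auto simp: C_def restrict_eq_iff)
  next
    fix f assume "f \<in> C g"
    then have f: "f \<in> G" "\<And>u. u \<in> words k \<Longrightarrow> f u = g u" by (auto simp: C_def restrict_eq_iff)
    have gt: "g \<in> tree_aut" using subgroupD(1)[OF assms g] .
    let ?s = "f \<circ> inv\<^bsub>AutX\<^esub> g"
    have "?s \<in> G" using f(1) g assms by (auto simp: subgroup_AutX_iff)
    moreover have "?s v = v" if "length v = k" for v
      using f(2)[of "(inv\<^bsub>AutX\<^esub> g) v"] that gt by (simp add: words_def tree_aut_length)
    ultimately have "?s \<in> level_stab G k" by (simp add: level_stab_def)
    moreover have "f = ?s \<circ> g" using gt by (simp add: fun_eq_iff)
    ultimately show "f \<in> level_stab G k #>\<^bsub>AutX\<lparr>carrier := G\<rparr>\<^esub> g"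
      by (auto simp: r_coset_def)
  qed
  have "order (mod_level G k) = card (C ` G)"
    unfolding order_def mod_level_def FactGroup_def RCOSETS_def
    using coset by (simp add: UNION_singleton_eq_range r_coset_def cong: image_cong)
  also have "\<dots> = card (?r ` G)"
    by (rule card_image_cong) (auto simp: C_def)
  finally show ?thesis by (simp add: act_count_def)
qed

lemma Cons_in_words [simp]: "x # u \<in> words (Suc k) \<longleftrightarrow> u \<in> words k"
  by (simp add: words_def)

lemma restrict_node_eq_iff:
  assumes "\<tau> \<in> {id, Not}" "\<tau>' \<in> {id, Not}"
  shows "restrict (node f0 f1 \<tau>) (words (Suc k)) = restrict (node g0 g1 \<tau>') (words (Suc k)) \<longleftrightarrow>
    restrict f0 (words k) = restrict g0 (words k) \<and> restrict f1 (words k) = restrict g1 (words k) \<and> \<tau> = \<tau>'"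
  (is "?L \<longleftrightarrow> ?R")
proof
  assume ?L
  then have *: "node f0 f1 \<tau> (x # u) = node g0 g1 \<tau>' (x # u)" if "u \<in> words k" for x u
    using that unfolding restrict_eq_iff by (metis Cons_in_words)
  have "replicate k False \<in> words k" by (simp add: words_def)
  from *[OF this] have "\<tau> = \<tau>'" by (auto simp: fun_eq_iff)
  then show ?R using *[of _ False] *[of _ True] unfolding restrict_eq_iff by auto
next
  assume R: ?R
  have "node f0 f1 \<tau> u = node g0 g1 \<tau>' u" if "u \<in> words (Suc k)" for u
    using that R unfolding restrict_eq_iff by (cases u) (auto simp: words_def)
  then show ?L unfolding restrict_eq_iff by blast
qed

lemma id_neq_Not: "id \<noteq> Not"
  by (metis id_apply)

text \<open>On level \<open>Suc k\<close> a node amounts to three independent data, the actions of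
  its two sections on level \<open>k\<close> and its root permutation.\<close>

lemma act_count_nodes:
  assumes "S \<subseteq> tree_aut" "T \<subseteq> tree_aut" "P \<subseteq> {id, Not}"
  shows "act_count ((\<lambda>(f, g, \<tau>). node f g \<tau>) ` (S \<times> T \<times> P)) (Suc k)
    = act_count S k * act_count T k * card P"
proof -
  let ?r = "\<lambda>f. restrict f (words k)"
  let ?h = "\<lambda>(f, g, \<tau>). (?r f, ?r g, \<tau>)"
  have "act_count ((\<lambda>(f, g, \<tau>). node f g \<tau>) ` (S \<times> T \<times> P)) (Suc k)
      = card ((\<lambda>(f, g, \<tau>). restrict (node f g \<tau>) (words (Suc k))) ` (S \<times> T \<times> P))"
    unfolding act_count_def image_image by (rule arg_cong[where f = card], rule image_cong) auto
  also have "\<dots> = card (?h ` (S \<times> T \<times> P))"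
    by (rule card_image_cong) (use assms(3) in \<open>auto simp: restrict_node_eq_iff subset_iff\<close>)
  also have "?h ` (S \<times> T \<times> P) = ?r ` S \<times> ?r ` T \<times> P"
    by (force simp: image_iff)
  finally show ?thesis by (simp add: act_count_def card_cartesian_product)
qed

text \<open>One binary choice is made at each of the \<open>2 ^ k - 1\<close> vertices above level
  \<open>k\<close>.\<close>

lemma act_count_tree_aut: "act_count tree_aut k = 2 ^ (2 ^ k - 1)"
proof (induction k)
  case 0
  have "f u = u" if "f \<in> tree_aut" "u \<in> words 0" for f u
    using that tree_aut_Nil by (auto simp: words_def)
  then have "(\<lambda>f. restrict f (words 0)) ` tree_aut = {restrict id (words 0)}"
    using tree_aut_id by (auto simp: restrict_eq_iff image_iff intro!: bexI[OF _ tree_aut_id])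
  then show ?case by (simp add: act_count_def)
next
  case (Suc k)
  have "tree_aut = (\<lambda>(f, g, \<tau>). node f g \<tau>) ` (tree_aut \<times> tree_aut \<times> {id, Not})"
    using tree_aut_node bij_Not bij_id by (force simp: image_iff elim: tree_aut_node_cases)
  then have "act_count tree_aut (Suc k) = act_count tree_aut k * act_count tree_aut k * card {id, Not}"
    using act_count_nodes[of tree_aut tree_aut "{id, Not}" k] by simp
  also have "card {id, Not} = 2" using id_neq_Not by simp
  also have "act_count tree_aut k * act_count tree_aut k * 2 = 2 ^ (2 ^ Suc k - 1)"
  proof -
    have "(2::nat) ^ Suc k - 1 = (2 ^ k - 1) + (2 ^ k - 1) + 1"
      using one_le_power[of "2::nat" k] unfolding power_Suc by linarith
    then show ?thesis by (simp only: Suc power_add power_one_right)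
  qed
  finally show ?case .
qed

section \<open>Copies of automorphisms on subtrees\<close>

lemma graft_pair: "graft [False] f \<circ> graft [True] g = node f g id"
proof
  fix u show "(graft [False] f \<circ> graft [True] g) u = node f g id u"
    by (cases u) (simp_all add: graft_Cons graft_Nil)
qed

lemma graft_append: "graft (v @ w) f = graft v (graft w f)"
  by (induction v) (simp_all add: graft_Nil graft_Cons)

lemma graft_comp: "graft w (f \<circ> g) = graft w f \<circ> graft w g"
  by (auto simp: fun_eq_iff graft_def)

lemma graft_id: "graft w id = id"
  by (auto simp: fun_eq_iff graft_def prefix_def)

lemma graft_inv:
  assumes "f \<in> tree_aut"
  shows "graft w (inv\<^bsub>AutX\<^esub> f) = inv\<^bsub>AutX\<^esub> (graft w f)"
proof (rule sym, rule tree_aut_inv_eqI)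
  fix u
  show "graft w (inv\<^bsub>AutX\<^esub> f) (graft w f u) = u"
    using assms by (cases "prefix w u") (auto simp: graft_def prefix_def)
qed (use assms in \<open>simp_all add: tree_aut_graft\<close>)

text \<open>Copies of \<open>T\<close> at the \<open>2 ^ j\<close> vertices of level
  \<open>j\<close> act on disjoint subtrees, so their actions can be chosen independently. The
  induction peels off the first letter of the vertex; closure under composition joins the two
  halves.\<close>

lemma act_count_graft:
  assumes "S \<subseteq> tree_aut" "T \<subseteq> tree_aut" "\<And>f g. f \<in> S \<Longrightarrow> g \<in> S \<Longrightarrow> f \<circ> g \<in> S"
    and "\<And>w f. w \<in> words j \<Longrightarrow> f \<in> T \<Longrightarrow> graft w f \<in> S"
  shows "act_count T k ^ (2 ^ j) \<le> act_count S (j + k)"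
  using assms(1,3,4)
proof (induction j arbitrary: S)
  case 0
  then have "T \<subseteq> S" by (auto simp: words_def graft_Nil)
  then show ?case using 0 by (simp add: act_count_mono)
next
  case (Suc j)
  \<comment> \<open>\<open>R x\<close> collects the automorphisms whose copy below the letter
    \<open>x\<close> lies in \<open>S\<close>; it inherits the hypotheses on \<open>S\<close> with
    \<open>j\<close> lowered by one.\<close>
  define R where "R x = {f \<in> tree_aut. graft [x] f \<in> S}" for x
  have IH: "act_count T k ^ (2 ^ j) \<le> act_count (R x) (j + k)" for x
  proof (rule Suc.IH)
    fix w f assume "w \<in> words j" "f \<in> T"
    then show "graft w f \<in> R x"
      using Suc.prems(3)[of "x # w" f] assms(2) graft_append[of "[x]" w f]
      by (auto simp: R_def tree_aut_graft)
  next
    fix f g assume "f \<in> R x" "g \<in> R x"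
    then show "f \<circ> g \<in> R x"
      unfolding R_def mem_Collect_eq graft_comp using tree_aut_comp Suc.prems(2) by blast
  qed (simp add: R_def)
  have "(\<lambda>(f, g, \<tau>). node f g \<tau>) ` (R False \<times> R True \<times> {id}) \<subseteq> S"
  proof clarify
    fix f g assume "f \<in> R False" "g \<in> R True"
    then show "node f g id \<in> S"
      unfolding R_def mem_Collect_eq graft_pair[symmetric] using Suc.prems(2) by blast
  qed
  then have "act_count ((\<lambda>(f, g, \<tau>). node f g \<tau>) ` (R False \<times> R True \<times> {id})) (Suc (j + k))
      \<le> act_count S (Suc (j + k))"
    using Suc.prems(1) by (rule act_count_mono)
  moreover have "R x \<subseteq> tree_aut" for x by (auto simp: R_def)
  ultimately have "act_count (R False) (j + k) * act_count (R True) (j + k) \<le> act_count S (Suc (j + k))"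
    by (simp add: act_count_nodes)
  moreover have "act_count T k ^ (2 ^ Suc j) = act_count T k ^ (2 ^ j) * act_count T k ^ (2 ^ j)"
    by (simp add: mult_2 power_add)
  moreover have "\<dots> \<le> act_count (R False) (j + k) * act_count (R True) (j + k)"
    by (rule mult_le_mono) (rule IH)+
  ultimately show ?case by simp
qed

section \<open>Commutators and grafting\<close>
lemma (in group) cancel_inv:
  assumes "x \<in> carrier G" "y \<in> carrier G"
  shows "inv x \<otimes> (x \<otimes> y) = y" "x \<otimes> (inv x \<otimes> y) = y"
  using assms by (simp_all add: m_assoc[symmetric])
text \<open>Commuting with \<open>t\<close> modulo \<open>N\<close> passes to products and inverses
  because conjugation preserves \<open>N\<close>: \<open>[xy, t] = x[y, t]x^-1 [x, t]\<close> and
  \<open>[s^-1, t] = s^-1 [s, t]^-1 s\<close>.\<close>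

lemma (in group) commutator_generate:
  assumes S: "S \<subseteq> carrier G" and N: "subgroup N G"
    and conj: "\<And>g x. g \<in> generate G S \<Longrightarrow> x \<in> N \<Longrightarrow> g \<otimes> x \<otimes> inv g \<in> N"
    and t: "t \<in> carrier G" and comm: "\<And>s. s \<in> S \<Longrightarrow> s \<otimes> t \<otimes> inv s \<otimes> inv t \<in> N"
    and x: "x \<in> generate G S"
  shows "x \<otimes> t \<otimes> inv x \<otimes> inv t \<in> N"
  using x
proof induction
  case one
  then show ?case using t subgroup.one_closed[OF N] by simp
next
  case (incl s)
  then show ?case by (rule comm)
next
  case (inv s)
  then have s: "s \<in> carrier G" using S by blast
  have "inv s \<otimes> inv (s \<otimes> t \<otimes> inv s \<otimes> inv t) \<otimes> inv (inv s) \<in> N"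
    by (intro conj generate.inv inv subgroup.m_inv_closed[OF N] comm)
  also have "inv s \<otimes> inv (s \<otimes> t \<otimes> inv s \<otimes> inv t) \<otimes> inv (inv s)
      = inv s \<otimes> t \<otimes> inv (inv s) \<otimes> inv t"
    using s t by (simp add: inv_mult_group m_assoc cancel_inv)
  finally show ?case .
next
  case (eng x y)
  then have xy: "x \<in> carrier G" "y \<in> carrier G" using generate_in_carrier[OF S] by auto
  have "(x \<otimes> (y \<otimes> t \<otimes> inv y \<otimes> inv t) \<otimes> inv x) \<otimes> (x \<otimes> t \<otimes> inv x \<otimes> inv t) \<in> N"
    by (intro subgroup.m_closed[OF N] conj eng)
  also have "(x \<otimes> (y \<otimes> t \<otimes> inv y \<otimes> inv t) \<otimes> inv x) \<otimes> (x \<otimes> t \<otimes> inv x \<otimes> inv t)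
      = x \<otimes> y \<otimes> t \<otimes> inv (x \<otimes> y) \<otimes> inv t"
    using xy t by (simp add: inv_mult_group m_assoc cancel_inv)
  finally show ?case .
qed
text \<open>\<open>commutator_generate\<close> is applied once in each argument of the commutator;
  inverting a commutator swaps its arguments.\<close>

lemma (in group) derived_generate_subset:
  assumes S: "S \<subseteq> carrier G" and N: "subgroup N G"
    and conj: "\<And>g x. g \<in> generate G S \<Longrightarrow> x \<in> N \<Longrightarrow> g \<otimes> x \<otimes> inv g \<in> N"
    and comm: "\<And>s t. s \<in> S \<Longrightarrow> t \<in> S \<Longrightarrow> s \<otimes> t \<otimes> inv s \<otimes> inv t \<in> N"
  shows "derived G (generate G S) \<subseteq> N"
proof -
  have carr: "x \<in> carrier G" if "x \<in> generate G S" for x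
    using that generate_in_carrier[OF S] by blast
  have left: "x \<otimes> s \<otimes> inv x \<otimes> inv s \<in> N" if "s \<in> S" "x \<in> generate G S" for s x
    using that S by (intro commutator_generate[OF S N conj _ comm]) auto
  have comm_inv: "y \<otimes> x \<otimes> inv y \<otimes> inv x \<in> N"
    if "x \<otimes> y \<otimes> inv x \<otimes> inv y \<in> N" "x \<in> carrier G" "y \<in> carrier G" for x y
    using subgroup.m_inv_closed[OF N that(1)] that(2,3) by (simp add: inv_mult_group m_assoc)
  have "x \<otimes> y \<otimes> inv x \<otimes> inv y \<in> N" if "x \<in> generate G S" "y \<in> generate G S" for x y
  proof (rule commutator_generate[OF S N conj carr[OF that(2)] _ that(1)])
    fix s assume "s \<in> S"
    then show "s \<otimes> y \<otimes> inv s \<otimes> inv y \<in> N"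
      using left[of s y] that(2) S carr by (intro comm_inv[of y s]) auto
  qed
  then have "derived_set G (generate G S) \<subseteq> N" by blast
  then show ?thesis
    unfolding derived_def using N by (rule generate_subgroup_incl)
qed
text \<open>The conjugate of \<open>x\<close> by \<open>g\<close> equals \<open>[g, x] x\<close>,
  and both factors lie in the derived subgroup.\<close>

lemma (in group) derived_conj:
  assumes "subgroup K G" "g \<in> K" "x \<in> derived G K"
  shows "g \<otimes> x \<otimes> inv g \<in> derived G K"
proof -
  have K: "K \<subseteq> carrier G" using assms(1) by (rule subgroup.subset)
  have x: "x \<in> K" using derived_incl[OF subset_refl assms(1)] assms(3) by blast
  have "g \<otimes> x \<otimes> inv g \<otimes> inv x \<in> derived_set G K" using assms(2) x by blast
  then have "g \<otimes> x \<otimes> inv g \<otimes> inv x \<in> derived G K"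
    unfolding derived_def by (rule generate.incl)
  then have "g \<otimes> x \<otimes> inv g \<otimes> inv x \<otimes> x \<in> derived G K"
    using assms(3) unfolding derived_def by (rule generate.eng)
  also have "g \<otimes> x \<otimes> inv g \<otimes> inv x \<otimes> x = g \<otimes> x \<otimes> inv g"
    using x assms(2) K by (simp add: subset_iff m_assoc)
  finally show ?thesis .
qed

section \<open>Commutators and conjugates of grafts\<close>

lemma commutator_eqI:
  assumes f: "f \<in> tree_aut" and g: "g \<in> tree_aut" and eq: "f \<circ> g = h \<circ> (g \<circ> f)"
  shows "f \<circ> g \<circ> inv\<^bsub>AutX\<^esub> f \<circ> inv\<^bsub>AutX\<^esub> g = h"
proof
  fix u
  have "f (g v) = h (g (f v))" for v using eq by (simp add: fun_eq_iff)
  then show "(f \<circ> g \<circ> inv\<^bsub>AutX\<^esub> f \<circ> inv\<^bsub>AutX\<^esub> g) u = h u" using f g by simp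
qed

lemma graft_conj:
  assumes "h \<in> tree_aut" "s \<in> tree_aut" "x \<in> tree_aut" and lift: "\<And>u. h (w @ u) = w' @ s u"
  shows "h \<circ> graft w x \<circ> inv\<^bsub>AutX\<^esub> h = graft w' (s \<circ> x \<circ> inv\<^bsub>AutX\<^esub> s)"
proof
  fix v
  define u where "u = (inv\<^bsub>AutX\<^esub> h) v"
  have v: "v = h u" using assms(1) by (simp add: u_def)
  have "h (graft w x u) = graft w' (s \<circ> x \<circ> inv\<^bsub>AutX\<^esub> s) (h u)"
  proof (cases "prefix w u")
    case True
    then obtain t where "u = w @ t" by (auto simp: prefix_def)
    then show ?thesis using assms(2) by (simp add: graft_def lift)
  next
    case False
    have "\<not> prefix w' (h u)"
    proof
      assume "prefix w' (h u)"
      then obtain t where "h u = w' @ t" by (auto simp: prefix_def)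
      then have "h u = h (w @ (inv\<^bsub>AutX\<^esub> s) t)" using assms(2) by (simp add: lift)
      then have "u = w @ (inv\<^bsub>AutX\<^esub> s) t" using tree_aut_inj[OF assms(1)] by blast
      then show False using False by simp
    qed
    with False show ?thesis by (simp add: graft_def)
  qed
  then show "(h \<circ> graft w x \<circ> inv\<^bsub>AutX\<^esub> h) v = graft w' (s \<circ> x \<circ> inv\<^bsub>AutX\<^esub> s) v"
    using assms(1) by (simp add: v)
qed
text \<open>The sections at \<open>w\<close> of the elements of \<open>G\<close> that fix the vertex
  \<open>w\<close>.\<close>

definition lifts :: "(word \<Rightarrow> word) set \<Rightarrow> word \<Rightarrow> (word \<Rightarrow> word) set" where
  "lifts G w = {s \<in> tree_aut. \<exists>h\<in>G. \<forall>u. h (w @ u) = w @ s u}"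
text \<open>The rigid stabilizer of \<open>w\<close> in \<open>M\<close>, transported to the whole
  tree.\<close>

definition grafts :: "(word \<Rightarrow> word) set \<Rightarrow> word \<Rightarrow> (word \<Rightarrow> word) set" where
  "grafts M w = {x \<in> tree_aut. graft w x \<in> M}"
lemma subgroup_lifts:
  assumes "subgroup G AutX"
  shows "subgroup (lifts G w) AutX"
  unfolding subgroup_AutX_iff
proof (intro conjI ballI)
  note G = subgroupD[OF assms]
  show "lifts G w \<subseteq> tree_aut" by (auto simp: lifts_def)
  show "id \<in> lifts G w" using G(2) by (auto simp: lifts_def tree_aut_id intro!: bexI[of _ id])
  fix f assume "f \<in> lifts G w"
  then obtain h where h: "f \<in> tree_aut" "h \<in> G" "\<And>u. h (w @ u) = w @ f u" by (auto simp: lifts_def)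
  have "(inv\<^bsub>AutX\<^esub> h) (w @ u) = w @ (inv\<^bsub>AutX\<^esub> f) u" for u
  proof -
    have "w @ u = h (w @ (inv\<^bsub>AutX\<^esub> f) u)" using h by simp
    then show ?thesis using G(1)[OF h(2)] by simp
  qed
  then show "inv\<^bsub>AutX\<^esub> f \<in> lifts G w" using h G(4) by (auto simp: lifts_def)
  fix g assume "g \<in> lifts G w"
  then obtain k where k: "g \<in> tree_aut" "k \<in> G" "\<And>u. k (w @ u) = w @ g u" by (auto simp: lifts_def)
  have "h \<circ> k \<in> G" using h(2) k(2) by (rule G(3))
  then show "f \<circ> g \<in> lifts G w"
    unfolding lifts_def mem_Collect_eq using h k tree_aut_comp[OF h(1) k(1)]
    by (intro conjI bexI[of _ "h \<circ> k"]) simp_all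
qed
lemma subgroup_grafts:
  assumes "subgroup M AutX"
  shows "subgroup (grafts M w) AutX"
  unfolding subgroup_AutX_iff grafts_def mem_Collect_eq
  using subgroupD[OF assms] by (simp add: graft_id graft_comp graft_inv tree_aut_id tree_aut_comp)
lemma grafts_conj:
  assumes "subgroup G AutX" "\<And>g x. g \<in> G \<Longrightarrow> x \<in> M \<Longrightarrow> g \<circ> x \<circ> inv\<^bsub>AutX\<^esub> g \<in> M"
    and "s \<in> lifts G w" "x \<in> grafts M w"
  shows "s \<circ> x \<circ> inv\<^bsub>AutX\<^esub> s \<in> grafts M w"
proof -
  obtain h where h: "s \<in> tree_aut" "h \<in> G" "\<And>u. h (w @ u) = w @ s u"
    using assms(3) by (auto simp: lifts_def)
  have x: "x \<in> tree_aut" "graft w x \<in> M" using assms(4) by (auto simp: grafts_def)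
  have "h \<circ> graft w x \<circ> inv\<^bsub>AutX\<^esub> h = graft w (s \<circ> x \<circ> inv\<^bsub>AutX\<^esub> s)"
    using h(3) by (rule graft_conj[OF subgroupD(1)[OF assms(1) h(2)] h(1) x(1)])
  then have "graft w (s \<circ> x \<circ> inv\<^bsub>AutX\<^esub> s) \<in> M" using assms(2)[OF h(2) x(2)] by simp
  moreover have "s \<circ> x \<circ> inv\<^bsub>AutX\<^esub> s \<in> tree_aut"
    by (intro tree_aut_comp h(1) x(1) tree_aut_inverse(1))
  ultimately show ?thesis by (simp add: grafts_def)
qed
section \<open>The branching structure of the groups \<open>H n\<close>\<close>
text \<open>The shape of an element that fixes level \<open>n\<close> pointwise, given by its
  sections there. Such elements compose vertex by vertex, so commutators can be computed one vertex
  at a time.\<close>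

definition spread :: "nat \<Rightarrow> (word \<Rightarrow> word \<Rightarrow> word) \<Rightarrow> word \<Rightarrow> word" where
  "spread n F u = (if length u < n then u else take n u @ F (take n u) (drop n u))"
lemma spread_append: "length v = n \<Longrightarrow> spread n F (v @ u) = v @ F v u"
  by (simp add: spread_def)
lemma spread_comp: "spread n F \<circ> spread n F' = spread n (\<lambda>v. F v \<circ> F' v)"
  by (auto simp: fun_eq_iff spread_def)
lemma graft_spread: "length w = n \<Longrightarrow> graft w x = spread n (\<lambda>v. if v = w then x else id)"
  by (auto simp: fun_eq_iff spread_def graft_def prefix_def take_all_iff)
    (metis append_take_drop_id)
lemma spread_eqI:
  assumes "f \<in> tree_aut" "\<And>v u. length v = n \<Longrightarrow> f (v @ u) = v @ F v u"
  shows "f = spread n F"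
proof
  fix u show "f u = spread n F u"
  proof (cases "length u < n")
    case True
    define v where "v = u @ replicate (n - length u) False"
    have f: "f v = v @ F v []" using assms(2)[of v "[]"] True by (simp add: v_def)
    have "f u = take (length u) (f v)"
      using tree_aut_take[OF assms(1), of "length u" v] by (simp add: v_def)
    then show ?thesis using True f by (simp add: spread_def v_def)
  next
    case False
    then show ?thesis using assms(2)[of "take n u" "drop n u"] by (simp add: spread_def)
  qed
qed

section \<open>\<open>gen_a n\<close> as the adding machine on level \<open>n\<close>\<close>

definition ones :: "nat \<Rightarrow> nat \<Rightarrow> word" where
  "ones n i = replicate i True @ replicate (n - i) False"
text \<open>The least significant digit comes first, so that \<open>gen_a n\<close> adds 1, and
  \<open>ones n i\<close>, the vertex of the argument with index \<open>i\<close> in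
  \<open>delta\<close>, has value \<open>2 ^ i - 1\<close>.\<close>

fun val :: "word \<Rightarrow> nat" where
  "val [] = 0"
| "val (x # u) = of_bool x + 2 * val u"
lemma val_inj: "length u = length v \<Longrightarrow> val u = val v \<Longrightarrow> u = v"
proof (induction u v rule: list_induct2)
  case (Cons x u y v)
  have "x = y" using Cons.prems by (cases x; cases y) (simp_all, presburger+)
  then show ?case using Cons by simp
qed simp
lemma val_less: "val u < 2 ^ length u"
  by (induction u) auto
lemma val_replicate_False [simp]: "val (replicate k False) = 0"
  by (induction k) auto
lemma val_ones: "val (ones n i) + 1 = 2 ^ i"
proof -
  have "val (replicate i True @ replicate k False) + 1 = 2 ^ i" for k
    by (induction i) simp_all
  then show ?thesis by (simp add: ones_def)
qed
lemma length_ones [simp]: "i \<le> n \<Longrightarrow> length (ones n i) = n"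
  by (simp add: ones_def)
lemma ones_inj: "ones n i = ones n j \<Longrightarrow> i = j"
  using val_ones[of n i] val_ones[of n j] by simp
lemma gen_a_append: "n \<ge> 1 \<Longrightarrow> length v = n \<Longrightarrow> gen_a n (v @ u) = gen_a n v @ u"
proof (induction n arbitrary: v rule: gen_a.induct)
  case (3 n)
  then obtain x w where "v = x # w" "length w = Suc n" by (auto simp: length_Suc_conv)
  with 3 show ?case by simp
qed (auto simp: length_Suc_conv)
text \<open>The section of \<open>gen_a\<close> at the letter 1 passes the carry on; a carry beyond
  the last letter is lost, which is the reduction modulo \<open>2 ^ n\<close>.\<close>

lemma val_gen_a: "n \<ge> 1 \<Longrightarrow> length v = n \<Longrightarrow> val (gen_a n v) = (val v + 1) mod 2 ^ n"
proof (induction n arbitrary: v rule: gen_a.induct)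
  case (3 n)
  then obtain x u where v: "v = x # u" "length u = Suc n" by (auto simp: length_Suc_conv)
  show ?case
  proof (cases x)
    case True
    have "val (gen_a (Suc n) u) = (val u + 1) mod 2 ^ Suc n" using 3 v by simp
    then have "val (gen_a (Suc (Suc n)) v) = 2 * ((val u + 1) mod 2 ^ Suc n)" using v True by simp
    also have "\<dots> = (2 * (val u + 1)) mod (2 * 2 ^ Suc n)" by (rule mult_mod_right)
    finally show ?thesis using v True by (simp add: algebra_simps)
  next
    case False
    then show ?thesis using v val_less[of u] by simp
  qed
qed (auto simp: length_Suc_conv)
lemma gen_a_pow_append:
  assumes "n \<ge> 1" "length v = n"
  shows "(gen_a n ^^ k) (v @ u) = (gen_a n ^^ k) v @ u \<and> length ((gen_a n ^^ k) v) = n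
    \<and> val ((gen_a n ^^ k) v) = (val v + k) mod 2 ^ n"
proof (induction k)
  case 0
  then show ?case using assms val_less[of v] by simp
next
  case (Suc k)
  then show ?case using assms(1) tree_aut_length[OF gen_a_aut]
    by (simp add: gen_a_append val_gen_a mod_simps)
qed
lemma pow_in_subgroup:
  assumes "subgroup S AutX" "f \<in> S"
  shows "f ^^ k \<in> S"
proof (induction k)
  case 0
  then show ?case using subgroupD(2)[OF assms(1)] by (simp add: id_def)
next
  case (Suc k)
  then show ?case unfolding funpow.simps using subgroupD(3)[OF assms(1)] assms(2) by blast
qed
lemma gen_a_transitive:
  assumes "n \<ge> 1" "length v = n" "length w = n"
  obtains k where "(gen_a n ^^ k) v = w"
proof -
  \<comment> \<open>The summand \<open>2 ^ n\<close> keeps the subtraction of natural numbers from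
    being truncated and vanishes modulo \<open>2 ^ n\<close>.\<close>
  define k where "k = 2 ^ n - val v + val w"
  have "val v + k = 2 ^ n + val w" using val_less[of v] assms(2) by (simp add: k_def)
  then have "val ((gen_a n ^^ k) v) = val w"
    using gen_a_pow_append[OF assms(1,2), of k "[]"] val_less[of w] assms(3) by simp
  then show ?thesis
    using that[of k] gen_a_pow_append[OF assms(1,2), of k "[]"] assms(3) val_inj by metis
qed

section \<open>Sections of \<open>delta\<close> on level \<open>n\<close>\<close>

lemma foldr_single:
  assumes "distinct xs" "inj_on p (set xs)"
  shows "foldr (\<circ>) (map (\<lambda>i. if v = p i then g i else id) xs) id
    = (if v \<in> p ` set xs then g (the_inv_into (set xs) p v) else id)"
proof -
  have *: "foldr (\<circ>) (map (\<lambda>i. if v = p i then g i else id) ys) id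
      = (if v \<in> p ` set ys then g (the_inv_into (set xs) p v) else id)"
    if "distinct ys" "set ys \<subseteq> set xs" for ys
    using that
  proof (induction ys)
    case (Cons y ys)
    have "the_inv_into (set xs) p (p y) = y"
      using Cons.prems assms(2) by (intro the_inv_into_f_f) auto
    moreover have "p y \<notin> p ` set ys"
      using Cons.prems assms(2) by (auto simp: inj_on_def)
    ultimately show ?case using Cons by auto
  qed simp
  show ?thesis using *[of xs] assms(1) by simp
qed
text \<open>The factors sit at distinct vertices of one level, so at each vertex at most one of them
  is nontrivial.\<close>

lemma delta_spread:
  assumes "length gs = n"
  obtains F where "delta gs = spread n F" "\<And>i. i < n \<Longrightarrow> F (ones n i) = gs ! i"
    "\<And>v. (\<And>i. i < n \<Longrightarrow> v \<noteq> ones n i) \<Longrightarrow> F v = id"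
proof -
  define F where "F v = foldr (\<circ>) (map (\<lambda>i. if v = ones n i then gs ! i else id) [0..<n]) id" for v
  have inj: "inj_on (ones n) (set [0..<n])" by (auto simp: inj_on_def dest: ones_inj)
  have F: "F v = (if v \<in> ones n ` set [0..<n] then gs ! the_inv_into (set [0..<n]) (ones n) v else id)" for v
    unfolding F_def by (rule foldr_single) (use inj in auto)
  have "foldr (\<circ>) (map (\<lambda>i. graft (ones n i) (gs ! i)) xs) id
      = spread n (\<lambda>v. foldr (\<circ>) (map (\<lambda>i. if v = ones n i then gs ! i else id) xs) id)"
    if "set xs \<subseteq> {..<n}" for xs
    using that
  proof (induction xs)
    case Nil
    then show ?case by (simp add: fun_eq_iff spread_def)
  next
    case (Cons i xs)
    then have "length (ones n i) = n" by simp
    then have "graft (ones n i) (gs ! i) = spread n (\<lambda>v. if v = ones n i then gs ! i else id)"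
      by (rule graft_spread)
    moreover have "foldr (\<circ>) (f # fs) id = f \<circ> foldr (\<circ>) fs id"
      for f :: "word \<Rightarrow> word" and fs by simp
    ultimately show ?case using Cons by (simp only: list.map spread_comp list.set insert_subset)
  qed
  then have "delta gs = spread n F"
    unfolding delta_def assms F_def ones_def[symmetric] by (simp add: subset_iff)
  moreover have "F (ones n i) = gs ! i" if "i < n" for i
    using that the_inv_into_f_f[OF inj, of i] by (simp add: F)
  moreover have "F v = id" if "\<And>i. i < n \<Longrightarrow> v \<noteq> ones n i" for v
  proof -
    have "v \<notin> ones n ` set [0..<n]" using that by (metis atLeastLessThan_iff imageE set_upt)
    then show ?thesis by (simp only: F if_False)
  qed
  ultimately show ?thesis using that by blast
qed

section \<open>Uniqueness of sums of two powers of two\<close>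

lemma sum_pow2_le:
  assumes "(2::nat) ^ a + 2 ^ b = 2 ^ c + 2 ^ d" "a \<le> b" "c \<le> d"
  shows "c \<le> a"
proof (rule ccontr)
  \<comment> \<open>The right side would be divisible by \<open>2 ^ Suc a\<close>. The left side is
    so only if \<open>a = b\<close>, and then the right side is too large.\<close>
  assume "\<not> c \<le> a"
  then have ac: "Suc a \<le> c" "Suc a \<le> d" using assms(3) by simp_all
  then have "2 ^ Suc a dvd (2::nat) ^ c + 2 ^ d" by (intro dvd_add le_imp_power_dvd)
  then have dvd: "2 ^ Suc a dvd (2::nat) ^ a + 2 ^ b" using assms(1) by simp
  show False
  proof (cases "a = b")
    case True
    have "(2::nat) ^ Suc a \<le> 2 ^ c" "(2::nat) ^ Suc a \<le> 2 ^ d"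
      using ac by (intro power_increasing; simp)+
    moreover have "(2::nat) ^ b = 2 ^ a" "(0::nat) < 2 ^ a" using True by simp_all
    ultimately show False using assms(1) unfolding power_Suc by linarith
  next
    case False
    then have "2 ^ Suc a dvd (2::nat) ^ b" using assms(2) by (intro le_imp_power_dvd) simp
    then have "2 ^ Suc a dvd (2::nat) ^ a" using dvd by (simp only: dvd_add_left_iff)
    then show False by (simp add: dvd_power_iff_le)
  qed
qed
lemma sum_pow2_eq:
  assumes "(2::nat) ^ l + 2 ^ j = 2 ^ i + 2 ^ l'"
  shows "l = i \<or> l = l'"
proof -
  have *: "a = c \<and> b = d"
    if "(2::nat) ^ a + 2 ^ b = 2 ^ c + 2 ^ d" "a \<le> b" "c \<le> d" for a b c d
  proof -
    have "a = c" using sum_pow2_le[OF that] sum_pow2_le[OF that(1)[symmetric] that(3,2)] by simp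
    then show ?thesis using that(1) by simp
  qed
  show ?thesis
    using *[of l j i l'] *[of j l i l'] *[of l j l' i] *[of j l l' i] assms by (metis add.commute nat_le_linear)
qed
text \<open>Both sums lie between 1 and \<open>2 ^ n\<close>, and in that range the residue modulo
  \<open>2 ^ n\<close> determines the number.\<close>

lemma sum_pow2_mod_eq:
  assumes "((2::nat) ^ l + 2 ^ j) mod 2 ^ n = (2 ^ i + 2 ^ l') mod 2 ^ n"
    and "l < n" "j < n" "i < n" "l' < n"
  shows "l = i \<or> l = l'"
proof -
  have half: "2 * (2::nat) ^ k \<le> 2 ^ n" if "k < n" for k
    using that power_increasing[of "Suc k" n "2::nat"] by simp
  have le: "(2::nat) ^ l + 2 ^ j \<le> 2 ^ n" "(2::nat) ^ i + 2 ^ l' \<le> 2 ^ n"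
    using half[OF assms(2)] half[OF assms(3)] half[OF assms(4)] half[OF assms(5)] by linarith+
  have pos: "0 < (2::nat) ^ l + 2 ^ j" "0 < (2::nat) ^ i + 2 ^ l'" by simp_all
  have "a = b" if "a mod N = b mod N" "0 < a" "0 < b" "a \<le> N" "b \<le> N" for a b N :: nat
    using that by (cases "a = N"; cases "b = N") auto
  from this[OF assms(1) pos le] show ?thesis by (rule sum_pow2_eq)
qed
text \<open>The sections of \<open>delta gs\<close> sit at the vertices \<open>2 ^ i - 1\<close> of the cycle of \<open>gen_a n\<close>. Since the
  differences \<open>2 ^ i - 2 ^ j\<close> are distinct modulo \<open>2 ^ n\<close>, a suitable conjugate of \<open>delta gs\<close>
  under \<open>gen_a n\<close> overlaps with \<open>delta gs\<close> in a single vertex.\<close>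
lemma graft_derived_delta:
  fixes gs :: "(word \<Rightarrow> word) list"
  defines "G \<equiv> generate AutX {gen_a (length gs), delta gs}"
  assumes gs: "gs \<noteq> []" "set gs \<subseteq> tree_aut" and w: "length w = length gs"
    and x: "x \<in> derived AutX (generate AutX (set gs))"
  shows "graft w x \<in> derived AutX G"
proof -
  define n where "n = length gs"
  note w = w[folded n_def]
  let ?a = "gen_a n" and ?b = "delta gs" and ?D = "derived AutX G"
  have n: "n \<ge> 1" using gs(1) by (cases gs) (auto simp: n_def)
  obtain F where F: "?b = spread n F" "\<And>i. i < n \<Longrightarrow> F (ones n i) = gs ! i"
    "\<And>v. (\<And>i. i < n \<Longrightarrow> v \<noteq> ones n i) \<Longrightarrow> F v = id"
    using delta_spread[OF n_def[symmetric]] by blast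
  have gens: "{?a, ?b} \<subseteq> carrier AutX" using gs(2) gen_a_aut tree_aut_delta by simp
  have G: "subgroup G AutX"
    unfolding G_def n_def[symmetric] using gens by (rule AutX.generate_is_subgroup)
  note GD = subgroupD[OF G]
  have aG: "?a \<in> G" and bG: "?b \<in> G"
    unfolding G_def n_def[symmetric] by (auto intro: generate.incl)
  have akG: "?a ^^ k \<in> G" for k by (rule pow_in_subgroup[OF G aG])
  have gsi: "gs ! i \<in> tree_aut" if "i < n" for i
    using that gs(2) by (auto simp: n_def)
  have D: "subgroup ?D AutX"
    using GD(1) by (intro AutX.derived_is_subgroup) auto
  have Dconj: "g \<circ> y \<circ> inv\<^bsub>AutX\<^esub> g \<in> ?D" if "g \<in> G" "y \<in> ?D" for g y
    using AutX.derived_conj[OF G that] by simp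
  \<comment> \<open>A power of \<open>?a\<close> takes \<open>ones n i\<close> to \<open>w\<close>;
    conjugating \<open>?b\<close> by it turns the argument at \<open>ones n i\<close> into a section
    at \<open>w\<close>.\<close>
  have lift: "gs ! i \<in> lifts G w" if i: "i < n" for i
  proof -
    obtain k where k: "(?a ^^ k) (ones n i) = w"
      using gen_a_transitive[OF n _ w, of "ones n i"] i by auto
    let ?A = "?a ^^ k"
    have A: "?A \<in> tree_aut" using akG GD(1) by blast
    have Aw: "?A (ones n i @ u) = w @ u" for u
      using gen_a_pow_append[OF n, of "ones n i" k u] i k by simp
    have "(?A \<circ> ?b \<circ> inv\<^bsub>AutX\<^esub> ?A) (w @ u) = w @ (gs ! i) u" for u
    proof -
      have "(inv\<^bsub>AutX\<^esub> ?A) (w @ u) = ones n i @ u"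
        unfolding Aw[symmetric] using A by simp
      then show ?thesis using i by (simp add: F(1,2) spread_append Aw)
    qed
    moreover have "?A \<circ> ?b \<circ> inv\<^bsub>AutX\<^esub> ?A \<in> G" by (intro GD akG bG)
    ultimately show ?thesis using gsi[OF i] unfolding lifts_def by blast
  qed
  have comm: "gs ! i \<circ> gs ! j \<circ> inv\<^bsub>AutX\<^esub> (gs ! i) \<circ> inv\<^bsub>AutX\<^esub> (gs ! j) \<in> grafts ?D w"
    (is "?c \<in> _") if i: "i < n" and j: "j < n" for i j
  proof (cases "i = j")
    case True
    have "gs ! j \<circ> gs ! j \<circ> inv\<^bsub>AutX\<^esub> (gs ! j) \<circ> inv\<^bsub>AutX\<^esub> (gs ! j) = id"
      using gsi[OF j] by (simp add: fun_eq_iff)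
    then show ?thesis using True subgroupD(2)[OF D] tree_aut_id by (simp add: grafts_def graft_id)
  next
    case False
    \<comment> \<open>Conjugation by this power places \<open>gs ! j\<close> at the vertex
      \<open>ones n i\<close>, where \<open>?b\<close> itself has \<open>gs ! i\<close>; there the
      commutator of \<open>?b\<close> and its conjugate is \<open>?c\<close>.\<close>
    obtain k where k: "(?a ^^ k) (ones n j) = ones n i"
      using gen_a_transitive[OF n, of "ones n j" "ones n i"] i j by auto
    let ?A = "?a ^^ k"
    have A: "?A \<in> tree_aut" using akG GD(1) by blast
    let ?B = "?A \<circ> ?b \<circ> inv\<^bsub>AutX\<^esub> ?A"
    let ?F' = "\<lambda>v. F ((inv\<^bsub>AutX\<^esub> ?A) v)"
    have BG: "?B \<in> G" by (intro GD akG bG)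
    have B: "?B = spread n ?F'"
    proof (rule spread_eqI)
      show "?B \<in> tree_aut" using BG GD(1) by blast
      fix v u :: word assume v: "length v = n"
      define v' where "v' = (inv\<^bsub>AutX\<^esub> ?A) v"
      have v': "length v' = n" "v = ?A v'"
        using v A tree_aut_length[OF tree_aut_inverse(1)[OF A]] by (simp_all add: v'_def)
      have Av: "?A (v' @ u) = v @ u" for u
        using gen_a_pow_append[OF n v'(1), of k u] v'(2) by simp
      have "(inv\<^bsub>AutX\<^esub> ?A) (v @ u) = v' @ u"
        unfolding Av[symmetric] using A by simp
      then show "?B (v @ u) = v @ ?F' v u"
        using v'(1) by (simp add: F(1) spread_append Av v'_def[symmetric])
    qed
    \<comment> \<open>If both factors were nontrivial at another vertex, it would be
      \<open>ones n l\<close> and the image of some \<open>ones n l'\<close> under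
      \<open>?A\<close>. Then \<open>2 ^ l + 2 ^ j\<close> and \<open>2 ^ i + 2 ^ l'\<close> agree
      modulo \<open>2 ^ n\<close>, which forces \<open>i = l\<close> or
      \<open>i = j\<close>.\<close>
    have single: "F v = id \<or> ?F' v = id" if "v \<noteq> ones n i" for v
    proof (rule ccontr)
      assume "\<not> (F v = id \<or> ?F' v = id)"
      then obtain l l' where l: "l < n" "v = ones n l" "l' < n" "(inv\<^bsub>AutX\<^esub> ?A) v = ones n l'"
        using F(3) by metis
      have "?A (ones n l') = ones n l" unfolding l(4)[symmetric] l(2)[symmetric] using A by simp
      then have vl: "val (ones n l) = (val (ones n l') + k) mod 2 ^ n"
        using gen_a_pow_append[OF n, of "ones n l'" k] l by simp
      have vi: "val (ones n i) = (val (ones n j) + k) mod 2 ^ n"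
        using gen_a_pow_append[OF n, of "ones n j" k] j k by simp
      have sums: "(val (ones n l) + (val (ones n j) + k)) mod 2 ^ n
          = (val (ones n i) + (val (ones n l') + k)) mod 2 ^ n"
        unfolding vl vi by (metis mod_add_left_eq add.commute)
      then have "(2 ^ l + 2 ^ j) mod 2 ^ n = (2 ^ i + 2 ^ l') mod (2 ^ n :: nat)"
      proof -
        \<comment> \<open>The shift \<open>?m\<close> completes \<open>k\<close> to a multiple of
          \<open>2 ^ n\<close> and adds 1 to each of the two values, turning
          \<open>2 ^ i - 1\<close> into \<open>2 ^ i\<close>.\<close>
        let ?m = "2 ^ n * k - k + 2"
        have cancel: "X + (Y + k) + ?m = (X + 1) + (Y + 1) + 2 ^ n * k" for X Y :: nat
          by (simp add: algebra_simps)
        have "(val (ones n l) + (val (ones n j) + k) + ?m) mod 2 ^ n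
            = (val (ones n i) + (val (ones n l') + k) + ?m) mod 2 ^ n"
          using sums by (metis mod_add_left_eq)
        then show ?thesis unfolding cancel val_ones by simp
      qed
      then have "i = l \<or> i = j" using l i j by (intro sum_pow2_mod_eq[of i l' n l j]) auto
      then show False using that l(2) False by auto
    qed
    have "?b \<circ> ?B = graft (ones n i) ?c \<circ> (?B \<circ> ?b)"
    proof -
      have "?F' (ones n i) = gs ! j"
        unfolding k[symmetric] using A F(2)[OF j] by simp
      moreover have "gs ! i \<circ> gs ! j = ?c \<circ> (gs ! j \<circ> gs ! i)"
        using gsi[OF i] gsi[OF j] by (simp add: fun_eq_iff)
      ultimately have at: "F (ones n i) \<circ> ?F' (ones n i) = ?c \<circ> (?F' (ones n i) \<circ> F (ones n i))"
        by (simp only: F(2)[OF i])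
      have "F v \<circ> ?F' v = (if v = ones n i then ?c else id) \<circ> (?F' v \<circ> F v)" for v
      proof (cases "v = ones n i")
        case True
        then show ?thesis using at by (simp only: refl if_True)
      next
        case False
        then show ?thesis using single[OF False] by (elim disjE) (simp_all only: if_False id_comp comp_id)
      qed
      then show ?thesis
        using i unfolding B unfolding F(1) graft_spread[OF length_ones[OF less_imp_le[OF i]]] spread_comp by simp
    qed
    then have c: "?b \<circ> ?B \<circ> inv\<^bsub>AutX\<^esub> ?b \<circ> inv\<^bsub>AutX\<^esub> ?B = graft (ones n i) ?c"
      by (rule commutator_eqI[OF GD(1)[OF bG] GD(1)[OF BG]])
    have "?b \<circ> ?B \<circ> inv\<^bsub>AutX\<^esub> ?b \<circ> inv\<^bsub>AutX\<^esub> ?B \<in> derived_set AutX G"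
      using bG BG by auto
    then have cD: "graft (ones n i) ?c \<in> ?D"
      unfolding c derived_def by (rule generate.incl)
    obtain t where t: "(?a ^^ t) (ones n i) = w"
      using gen_a_transitive[OF n _ w, of "ones n i"] i by auto
    let ?T = "?a ^^ t"
    have T: "?T \<in> tree_aut" using akG GD(1) by blast
    have cA: "?c \<in> tree_aut" by (intro tree_aut_comp tree_aut_inverse(1) gsi i j)
    have "?T \<circ> graft (ones n i) ?c \<circ> inv\<^bsub>AutX\<^esub> ?T = graft w (id \<circ> ?c \<circ> inv\<^bsub>AutX\<^esub> id)"
      using gen_a_pow_append[OF n, of "ones n i" t] i t
      by (intro graft_conj T tree_aut_id cA) simp
    moreover have "inv\<^bsub>AutX\<^esub> id = id" using tree_aut_id by (intro inv_involution) simp_all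
    ultimately have "graft w ?c \<in> ?D" using Dconj[OF akG cD, of t] by simp
    then show ?thesis using cA by (simp add: grafts_def)
  qed
  \<comment> \<open>All arguments are sections at \<open>w\<close>, so the group they generate
    normalises \<open>grafts ?D w\<close>. Since that subgroup contains their mutual commutators, it
    contains the whole derived subgroup.\<close>
  have "generate AutX (set gs) \<subseteq> lifts G w"
    using subgroup_lifts[OF G] lift by (intro AutX.generate_subgroup_incl) (auto simp: in_set_conv_nth n_def)
  then have "derived AutX (generate AutX (set gs)) \<subseteq> grafts ?D w"
    using grafts_conj[OF G Dconj, of _ w] comm gs(2) subgroup_grafts[OF D]
    by (intro AutX.derived_generate_subset) (auto simp only: AutX_simps in_set_conv_nth n_def)
  then show ?thesis using x by (auto simp: grafts_def)
qed

section \<open>The groups generated by \<open>a\<close> and the \<open>b\<^bsub>(i,m)\<^esub>\<close>\<close>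

definition flip :: "word \<Rightarrow> word" where
  "flip = node id id Not"

lemma flip_simps [simp]: "flip [] = []" "flip (x # u) = (\<not> x) # u"
  by (simp_all add: flip_def)

lemma gen_a_1: "gen_a 1 = flip"
  by (simp add: flip_def)

lemma flip_flip [simp]: "flip (flip u) = u"
  by (cases u) simp_all

lemma flip_aut: "flip \<in> tree_aut"
  using gen_a_aut[of 1] by (simp only: gen_a_1)

lemma gen_b_False [simp]: "gen_b i m (False # w) = False # (if i < m then w else flip w)"
  by (simp only: gen_b.simps gen_a_1)

declare gen_b.simps(2) [simp del]

lemma gen_b_gen_b [simp]: "gen_b i m (gen_b i m u) = u"
  by (induction i m u rule: gen_b.induct) simp_all

text \<open>Every \<open>gen_b i m\<close> fixes the ray of ones and acts trivially or by
  \<open>flip\<close> on each subtree hanging off it.\<close>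

lemma gen_b_commute: "gen_b i m (gen_b j m u) = gen_b j m (gen_b i m u)"
proof (induction u arbitrary: i j)
  case (Cons x u)
  then show ?case by (cases x) simp_all
qed simp

lemma inv_flip: "inv\<^bsub>AutX\<^esub> flip = flip"
  by (intro inv_involution flip_aut flip_flip)

lemma inv_gen_b: "inv\<^bsub>AutX\<^esub> (gen_b i m) = gen_b i m"
  by (intro inv_involution gen_b_aut gen_b_gen_b)

text \<open>A commutator, since both factors are involutions.\<close>

definition flip_comm :: "nat \<Rightarrow> nat \<Rightarrow> word \<Rightarrow> word" where
  "flip_comm i m = flip \<circ> gen_b i m \<circ> flip \<circ> gen_b i m"

lemma flip_comm_aut: "flip_comm i m \<in> tree_aut"
  unfolding flip_comm_def by (intro tree_aut_comp flip_aut gen_b_aut)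

definition GB_gens :: "nat \<Rightarrow> (word \<Rightarrow> word) set" where
  "GB_gens m = insert flip ((\<lambda>i. gen_b i m) ` {1..m})"

definition GB :: "nat \<Rightarrow> (word \<Rightarrow> word) set" where
  "GB m = generate AutX (GB_gens m)"

text \<open>Including all conjugates makes \<open>KB m\<close> normalised by \<open>GB m\<close>.
  The index starts at 2 because the copies built in \<open>graft_False_flip_comm\<close> have index
  \<open>Suc j\<close> with \<open>j \<ge> 1\<close>; index 1 is adjoined only in
  \<open>KB1\<close>.\<close>

definition KB_gens :: "nat \<Rightarrow> (word \<Rightarrow> word) set" where
  "KB_gens m = {g \<circ> flip_comm i m \<circ> inv\<^bsub>AutX\<^esub> g |g i. g \<in> GB m \<and> i \<in> {2..m}}"

definition KB :: "nat \<Rightarrow> (word \<Rightarrow> word) set" where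
  "KB m = generate AutX (KB_gens m)"

lemma GB_gens_aut: "GB_gens m \<subseteq> tree_aut"
  using flip_aut gen_b_aut by (auto simp: GB_gens_def)

lemma subgroup_GB: "subgroup (GB m) AutX"
  unfolding GB_def using GB_gens_aut by (intro AutX.generate_is_subgroup) simp

lemma flip_GB: "flip \<in> GB m"
  unfolding GB_def GB_gens_def by (intro generate.incl) simp

lemma gen_b_GB: "i \<in> {1..m} \<Longrightarrow> gen_b i m \<in> GB m"
  unfolding GB_def GB_gens_def by (intro generate.incl) simp

lemma flip_comm_GB: "i \<in> {1..m} \<Longrightarrow> flip_comm i m \<in> GB m"
  unfolding flip_comm_def by (intro subgroupD(3)[OF subgroup_GB] flip_GB gen_b_GB)

lemma subgroup_KB: "subgroup (KB m) AutX"
  unfolding KB_def KB_gens_def using flip_comm_aut subgroupD(1)[OF subgroup_GB]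
  by (intro AutX.generate_is_subgroup) (auto intro!: tree_aut_comp tree_aut_inverse(1))

lemma KB_minimal:
  assumes "subgroup N AutX" "\<And>g x. g \<in> GB m \<Longrightarrow> x \<in> N \<Longrightarrow> g \<circ> x \<circ> inv\<^bsub>AutX\<^esub> g \<in> N"
    and "\<And>i. i \<in> {2..m} \<Longrightarrow> flip_comm i m \<in> N"
  shows "KB m \<subseteq> N"
  unfolding KB_def KB_gens_def using assms by (intro AutX.generate_subgroup_incl) blast+

lemma flip_comm_KB:
  assumes "i \<in> {2..m}"
  shows "flip_comm i m \<in> KB m"
proof -
  have "inv\<^bsub>AutX\<^esub> id = id" using tree_aut_id by (intro inv_involution) simp_all
  then have "flip_comm i m = id \<circ> flip_comm i m \<circ> inv\<^bsub>AutX\<^esub> id" by simp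
  then show ?thesis
    unfolding KB_def KB_gens_def using subgroupD(2)[OF subgroup_GB] assms by (intro generate.incl) blast
qed

lemma conj_comp:
  assumes "g \<in> tree_aut"
  shows "g \<circ> (x \<circ> y) \<circ> inv\<^bsub>AutX\<^esub> g = (g \<circ> x \<circ> inv\<^bsub>AutX\<^esub> g) \<circ> (g \<circ> y \<circ> inv\<^bsub>AutX\<^esub> g)"
  using assms by (simp add: fun_eq_iff)

lemma conj_inv:
  assumes "g \<in> tree_aut" "x \<in> tree_aut"
  shows "inv\<^bsub>AutX\<^esub> (g \<circ> x \<circ> inv\<^bsub>AutX\<^esub> g) = g \<circ> inv\<^bsub>AutX\<^esub> x \<circ> inv\<^bsub>AutX\<^esub> g"
proof (rule tree_aut_inv_eqI)
  show "g \<circ> inv\<^bsub>AutX\<^esub> x \<circ> inv\<^bsub>AutX\<^esub> g \<in> tree_aut" "g \<circ> x \<circ> inv\<^bsub>AutX\<^esub> g \<in> tree_aut"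
    by (intro tree_aut_comp tree_aut_inverse(1) assms)+
qed (use assms in simp)

lemma conj_conj:
  assumes "g \<in> tree_aut" "h \<in> tree_aut"
  shows "g \<circ> (h \<circ> x \<circ> inv\<^bsub>AutX\<^esub> h) \<circ> inv\<^bsub>AutX\<^esub> g = (g \<circ> h) \<circ> x \<circ> inv\<^bsub>AutX\<^esub> (g \<circ> h)"
proof -
  have "inv\<^bsub>AutX\<^esub> (g \<circ> h) = inv\<^bsub>AutX\<^esub> h \<circ> inv\<^bsub>AutX\<^esub> g"
    using AutX.inv_mult_group[of g h] assms by (simp only: AutX_simps)
  then show ?thesis by (simp only: comp_assoc)
qed

lemma KB_conj:
  assumes g: "g \<in> GB m" and x: "x \<in> KB m"
  shows "g \<circ> x \<circ> inv\<^bsub>AutX\<^esub> g \<in> KB m"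
proof -
  note K = subgroupD[OF subgroup_KB[of m]] and G = subgroupD[OF subgroup_GB[of m]]
  have R: "r \<in> KB m" if "r \<in> KB_gens m" for r unfolding KB_def using that by (rule generate.incl)
  have conj: "g \<circ> r \<circ> inv\<^bsub>AutX\<^esub> g \<in> KB m" if r: "r \<in> KB_gens m" for r
  proof -
    obtain h i where h: "r = h \<circ> flip_comm i m \<circ> inv\<^bsub>AutX\<^esub> h" "h \<in> GB m" "i \<in> {2..m}"
      using r unfolding KB_gens_def by blast
    then have "g \<circ> r \<circ> inv\<^bsub>AutX\<^esub> g = (g \<circ> h) \<circ> flip_comm i m \<circ> inv\<^bsub>AutX\<^esub> (g \<circ> h)"
      using conj_conj[OF G(1)[OF g] G(1)[OF h(2)]] by (simp only:)
    moreover have "(g \<circ> h) \<circ> flip_comm i m \<circ> inv\<^bsub>AutX\<^esub> (g \<circ> h) \<in> KB_gens m"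
      unfolding KB_gens_def using G(3)[OF g h(2)] h(3) by blast
    ultimately show ?thesis using R by (simp only:)
  qed
  from x have "x \<in> generate AutX (KB_gens m)" by (simp only: KB_def)
  then show ?thesis
  proof (induction rule: generate.induct)
    case one
    have "g \<circ> id \<circ> inv\<^bsub>AutX\<^esub> g = id" using G(1)[OF g] by (simp add: fun_eq_iff)
    then show ?case using K(2) by (simp only: AutX_simps)
  next
    case (incl r)
    then show ?case by (rule conj)
  next
    case (inv r)
    have "r \<in> tree_aut" using R[OF inv] K(1) by blast
    then show ?case
      using K(4)[OF conj[OF inv]] conj_inv[OF G(1)[OF g]] by (simp only:)
  next
    case (eng x y)
    then show ?case
      using conj_comp[OF G(1)[OF g], of x y] K(3)[OF eng.IH] by (simp only: AutX_simps)
  qed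
qed

lemma KB_subset_derived: "KB m \<subseteq> derived AutX (GB m)"
proof (rule KB_minimal)
  show "subgroup (derived AutX (GB m)) AutX"
    using subgroupD(1)[OF subgroup_GB] by (intro AutX.derived_is_subgroup) auto
  show "g \<circ> x \<circ> inv\<^bsub>AutX\<^esub> g \<in> derived AutX (GB m)"
    if "g \<in> GB m" "x \<in> derived AutX (GB m)" for g x
    using AutX.derived_conj[OF subgroup_GB that] by (simp only: AutX_simps)
  fix i assume i: "i \<in> {2..m}"
  have "flip \<otimes>\<^bsub>AutX\<^esub> gen_b i m \<otimes>\<^bsub>AutX\<^esub> inv\<^bsub>AutX\<^esub> flip \<otimes>\<^bsub>AutX\<^esub> inv\<^bsub>AutX\<^esub> (gen_b i m) \<in> derived_set AutX (GB m)"
    using flip_GB gen_b_GB[of i m] i by fastforce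
  then have "flip_comm i m \<in> derived_set AutX (GB m)"
    by (simp only: AutX_simps inv_flip inv_gen_b flip_comm_def)
  then show "flip_comm i m \<in> derived AutX (GB m)"
    unfolding derived_def by (rule generate.incl)
qed

section \<open>Regular branching\<close>

text \<open>\<open>GB m\<close> is self-replicating: at the letter 0, \<open>gen_b m m\<close> has
  section \<open>flip\<close>, and the conjugate of \<open>gen_b i m\<close> by \<open>flip\<close>
  has section \<open>gen_b (Suc i) m\<close> if \<open>i < m\<close> and \<open>gen_b 1 m\<close> if
  \<open>i = m\<close>. All generators occur.\<close>

lemma GB_lifts:
  assumes "m \<ge> 2"
  shows "GB m \<subseteq> lifts (GB m) [False]"
proof -
  note G = subgroupD(3)[OF subgroup_GB[of m]]
  have flip_b: "flip \<circ> gen_b i m \<circ> flip \<in> GB m" if "i \<in> {1..m}" for i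
    using that by (intro G flip_GB gen_b_GB)
  have m: "m \<in> {1..m}" using assms by simp
  have "s \<in> lifts (GB m) [False]" if "s \<in> GB_gens m" for s
  proof -
    consider "s = flip" | "s = gen_b 1 m" | i where "s = gen_b (Suc i) m" "i \<in> {1..m}" "i < m"
    proof -
      have i: "i = 1 \<or> (\<exists>k. i = Suc k \<and> k \<in> {1..m} \<and> k < m)" if "i \<in> {1..m}" for i
        using that by (cases i) auto
      have "s = flip \<or> (\<exists>i\<in>{1..m}. s = gen_b i m)"
        using \<open>s \<in> GB_gens m\<close> by (auto simp: GB_gens_def)
      then show ?thesis using that i by metis
    qed
    then show ?thesis
    proof cases
      case 1
      then show ?thesis
        using flip_aut gen_b_GB[of m m] assms unfolding lifts_def mem_Collect_eq
        by (intro conjI bexI[of _ "gen_b m m"]) simp_all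
    next
      case 2
      have "(flip \<circ> gen_b m m \<circ> flip) ([False] @ u) = [False] @ s u" for u using 2 by simp
      then show ?thesis
        using 2 gen_b_aut flip_b[OF m] unfolding lifts_def mem_Collect_eq
        by (intro conjI bexI[of _ "flip \<circ> gen_b m m \<circ> flip"] allI) (simp_all only: atLeastAtMost_iff)
    next
      case 3
      then have "(flip \<circ> gen_b i m \<circ> flip) ([False] @ u) = [False] @ s u" for u by simp
      then show ?thesis
        using 3 gen_b_aut flip_b[of i] unfolding lifts_def mem_Collect_eq
        by (intro conjI bexI[of _ "flip \<circ> gen_b i m \<circ> flip"] allI) (simp_all only: atLeastAtMost_iff)
    qed
  qed
  then show ?thesis
    using subgroup_lifts[OF subgroup_GB] unfolding GB_def
    by (intro AutX.generate_subgroup_incl) auto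
qed

text \<open>The sections of \<open>gen_b m m\<close> are \<open>flip\<close> and
  \<open>gen_b 1 m\<close>, those of the conjugate of \<open>gen_b j m\<close> by
  \<open>flip\<close> are \<open>gen_b (Suc j) m\<close> and \<open>id\<close>; their commutator
  survives only below the letter 0.\<close>

lemma graft_False_flip_comm:
  assumes "1 \<le> j" "j < m"
  shows "graft [False] (flip_comm (Suc j) m)
    = gen_b m m \<circ> (flip \<circ> gen_b j m \<circ> flip) \<circ> gen_b m m \<circ> (flip \<circ> gen_b j m \<circ> flip)"
    (is "?L = ?R")
proof
  fix u
  show "?L u = ?R u"
  proof (cases u)
    case Nil
    then show ?thesis by (simp add: graft_def)
  next
    case (Cons x w)
    then show ?thesis using assms by (cases x) (simp_all add: graft_def flip_comm_def)
  qed
qed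

lemma KB_graft_False:
  assumes "m \<ge> 2" "x \<in> KB m"
  shows "graft [False] x \<in> KB m"
proof -
  note K = subgroupD[OF subgroup_KB[of m]] and G = subgroupD[OF subgroup_GB[of m]]
  have "KB m \<subseteq> grafts (KB m) [False]"
  proof (rule KB_minimal)
    show "subgroup (grafts (KB m) [False]) AutX" by (rule subgroup_grafts[OF subgroup_KB])
    show "g \<circ> x \<circ> inv\<^bsub>AutX\<^esub> g \<in> grafts (KB m) [False]"
      if "g \<in> GB m" "x \<in> grafts (KB m) [False]" for g x
      using that GB_lifts[OF assms(1)] by (intro grafts_conj[OF subgroup_GB KB_conj]) auto
    fix i assume "i \<in> {2..m}"
    then obtain j where j: "i = Suc j" "1 \<le> j" "j < m" by (cases i) auto
    \<comment> \<open>The commutator of \<open>gen_b m m\<close> with the conjugate of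
      \<open>gen_b j m\<close> by \<open>flip\<close> is rewritten as \<open>?c\<close> times the
      conjugate of \<open>?c\<close> by \<open>?g\<close>, which visibly lies in
      \<open>KB m\<close>. This uses that \<open>gen_b m m\<close> and \<open>gen_b j m\<close>
      commute.\<close>
    let ?c = "inv\<^bsub>AutX\<^esub> (flip_comm m m)" and ?g = "flip \<circ> gen_b j m"
    have c: "?c = gen_b m m \<circ> flip \<circ> gen_b m m \<circ> flip"
      by (rule tree_aut_inv_eqI)
        (intro tree_aut_comp flip_aut gen_b_aut flip_comm_aut, rule flip_comm_aut, simp add: flip_comm_def)
    have g: "inv\<^bsub>AutX\<^esub> ?g = gen_b j m \<circ> flip"
      by (rule tree_aut_inv_eqI) (intro tree_aut_comp flip_aut gen_b_aut, intro tree_aut_comp flip_aut gen_b_aut, simp)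
    have "?c \<in> KB m" using assms(1) by (intro K(4) flip_comm_KB) simp
    moreover have "?g \<in> GB m" using j by (intro G(3) flip_GB gen_b_GB) simp
    ultimately have "?c \<circ> (?g \<circ> ?c \<circ> inv\<^bsub>AutX\<^esub> ?g) \<in> KB m" by (intro K(3) KB_conj)
    also have "?c \<circ> (?g \<circ> ?c \<circ> inv\<^bsub>AutX\<^esub> ?g) = graft [False] (flip_comm (Suc j) m)"
      unfolding graft_False_flip_comm[OF j(2,3)] c g
      using gen_b_commute[of m m j] by (simp add: fun_eq_iff)
    finally show "flip_comm i m \<in> grafts (KB m) [False]"
      using j(1) flip_comm_aut by (simp add: grafts_def)
  qed
  then show ?thesis using assms(2) by (auto simp: grafts_def)
qed

text \<open>Iterates the step at the letter 0 along \<open>w\<close>; a copy below the letter 1 is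
  the conjugate by \<open>flip\<close> of a copy below the letter 0.\<close>

lemma KB_graft:
  assumes "m \<ge> 2" "x \<in> KB m"
  shows "graft w x \<in> KB m"
proof (induction w)
  case Nil
  then show ?case using assms(2) by (simp add: graft_Nil)
next
  case (Cons c w)
  let ?y = "graft w x"
  have y: "?y \<in> tree_aut" using Cons subgroupD(1)[OF subgroup_KB] by blast
  have F: "graft [False] ?y \<in> KB m" using assms(1) Cons by (rule KB_graft_False)
  have inv_id: "inv\<^bsub>AutX\<^esub> id = id" using tree_aut_id by (intro inv_involution) simp_all
  have "flip \<circ> graft [False] ?y \<circ> inv\<^bsub>AutX\<^esub> flip = graft [True] (id \<circ> ?y \<circ> inv\<^bsub>AutX\<^esub> id)"
    by (rule graft_conj) (simp_all add: flip_aut tree_aut_id y)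
  then have "graft [True] ?y \<in> KB m"
    using KB_conj[OF flip_GB F] by (simp add: inv_id)
  moreover have "graft (c # w) x = graft [c] ?y" using graft_append[of "[c]" w x] by simp
  ultimately show ?case using F by (cases c) simp_all
qed

section \<open>The index of \<open>KB m\<close> and the size of \<open>KB m\<close> on level \<open>m + 1\<close>\<close>

text \<open>Two cosets suffice since the square of \<open>x\<close> falls back into
  \<open>N\<close>. Each extension step in the index bound for \<open>KB m\<close> is of this
  kind.\<close>

lemma (in group) adjoin_square_root:
  assumes N: "subgroup N G" and x: "x \<in> carrier G" "x \<otimes> x \<in> N"
    and conj: "\<And>y. y \<in> N \<Longrightarrow> x \<otimes> y \<otimes> inv x \<in> N"
  shows "subgroup (N \<union> (\<lambda>y. y \<otimes> x) ` N) G"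
proof (rule subgroupI)
  note N1 = subgroup.subset[OF N] and N2 = subgroup.m_closed[OF N] and N3 = subgroup.m_inv_closed[OF N]
  note simps = inv_mult_group m_assoc cancel_inv x(1) subset_iff
  let ?M = "N \<union> (\<lambda>y. y \<otimes> x) ` N"
  show "?M \<subseteq> carrier G" "?M \<noteq> {}" using N1 x(1) subgroup.one_closed[OF N] by auto
  \<comment> \<open>Conjugation by \<open>inv x\<close> is conjugation by \<open>x\<close> followed
    by conjugation by the inverse of \<open>x \<otimes> x\<close>, an element of
    \<open>N\<close>.\<close>
  have conj': "inv x \<otimes> y \<otimes> x \<in> N" if y: "y \<in> N" for y
  proof -
    have yc: "y \<in> carrier G" using y N1 by blast
    have "inv (x \<otimes> x) \<otimes> (x \<otimes> y \<otimes> inv x) \<otimes> (x \<otimes> x) \<in> N"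
      by (intro N2 N3 x(2) conj y)
    also have "inv (x \<otimes> x) \<otimes> (x \<otimes> y \<otimes> inv x) \<otimes> (x \<otimes> x) = inv x \<otimes> y \<otimes> x"
      using yc by (simp add: simps)
    finally show ?thesis .
  qed
  show "inv u \<in> ?M" if "u \<in> ?M" for u
    using that
  proof
    assume "u \<in> (\<lambda>y. y \<otimes> x) ` N"
    then obtain y where y: "y \<in> N" "u = y \<otimes> x" by blast
    have yc: "y \<in> carrier G" using y(1) N1 by blast
    have "(inv x \<otimes> inv y \<otimes> x) \<otimes> inv (x \<otimes> x) \<in> N" by (intro N2 N3 x(2) conj' y(1))
    moreover have "inv u = ((inv x \<otimes> inv y \<otimes> x) \<otimes> inv (x \<otimes> x)) \<otimes> x"
      using yc by (simp add: simps y(2))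
    ultimately show ?thesis by blast
  qed (use N3 in blast)
  show "u \<otimes> v \<in> ?M" if "u \<in> ?M" "v \<in> ?M" for u v
  proof -
    consider "u \<in> N" "v \<in> N" | y where "u \<in> N" "v = y \<otimes> x" "y \<in> N"
      | y where "u = y \<otimes> x" "y \<in> N" "v \<in> N" | y z where "u = y \<otimes> x" "y \<in> N" "v = z \<otimes> x" "z \<in> N"
      using \<open>u \<in> ?M\<close> \<open>v \<in> ?M\<close> by blast
    then show ?thesis
    proof cases
      case 1
      then show ?thesis using N2 by blast
    next
      case 2
      then have "u \<otimes> v = (u \<otimes> y) \<otimes> x" using N1 by (simp add: simps)
      then show ?thesis using 2 N2 by blast
    next
      case 3
      then have "u \<otimes> v = (y \<otimes> (x \<otimes> v \<otimes> inv x)) \<otimes> x" using N1 by (simp add: simps)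
      moreover have "y \<otimes> (x \<otimes> v \<otimes> inv x) \<in> N" by (intro N2 conj 3)
      ultimately show ?thesis by blast
    next
      case 4
      then have "u \<otimes> v = y \<otimes> (x \<otimes> z \<otimes> inv x) \<otimes> (x \<otimes> x)" using N1 by (simp add: simps)
      moreover have "y \<otimes> (x \<otimes> z \<otimes> inv x) \<otimes> (x \<otimes> x) \<in> N" by (intro N2 conj 4 x(2))
      ultimately show ?thesis by simp
    qed
  qed
qed

text \<open>Composing with \<open>x\<close> on the right only relabels the words of the level, so
  the coset shows no more actions than \<open>S\<close> does.\<close>

lemma act_count_Un_coset:
  assumes "S \<subseteq> tree_aut" "x \<in> tree_aut"
  shows "act_count (S \<union> (\<lambda>y. y \<circ> x) ` S) k \<le> 2 * act_count S k"
proof -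
  let ?r = "\<lambda>f. restrict f (words k)"
  have "?r ` (\<lambda>y. y \<circ> x) ` S = (\<lambda>h. restrict (h \<circ> x) (words k)) ` ?r ` S"
    unfolding image_image
    by (rule image_cong) (auto simp: restrict_eq_iff tree_aut_words[OF assms(2)])
  then have "card (?r ` (\<lambda>y. y \<circ> x) ` S) \<le> card (?r ` S)"
    using card_image_le[OF finite_restrict_image[OF assms(1)]] by simp
  moreover have "act_count (S \<union> (\<lambda>y. y \<circ> x) ` S) k \<le> card (?r ` S) + card (?r ` (\<lambda>y. y \<circ> x) ` S)"
    unfolding act_count_def image_Un by (rule card_Un_le)
  ultimately show ?thesis by (simp add: act_count_def)
qed

text \<open>Modulo \<open>KB1 m\<close> the group \<open>GB m\<close> is abelian and generated by \<open>m + 1\<close> involutions.\<close>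

definition KB1 :: "nat \<Rightarrow> (word \<Rightarrow> word) set" where
  "KB1 m = KB m \<union> (\<lambda>y. y \<circ> flip_comm 1 m) ` KB m"

lemma KB_subset_GB: "KB m \<subseteq> GB m"
  using KB_subset_derived AutX.derived_incl[OF subset_refl subgroup_GB] by blast

section \<open>Centrality of \<open>flip_comm 1 m\<close> modulo \<open>KB m\<close>\<close>

lemma flip_comm_1:
  assumes "m \<ge> 2"
  shows "flip_comm 1 m (x # u) = x # gen_b 2 m u"
  using assms by (cases x) (simp_all add: flip_comm_def numeral_2_eq_2)

lemma flip_comm_1_invol:
  assumes "m \<ge> 2"
  shows "flip_comm 1 m (flip_comm 1 m u) = u"
proof (cases u)
  case Nil
  then show ?thesis by (simp add: flip_comm_def)
next
  case (Cons x w)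
  then show ?thesis using assms by (simp only: flip_comm_1 gen_b_gen_b)
qed

text \<open>Since \<open>flip_comm 1 m\<close> has the section \<open>gen_b 2 m\<close> at both
  letters, it commutes with \<open>flip\<close> and with \<open>gen_b i m\<close> for
  \<open>i < m\<close>. With \<open>gen_b m m\<close> the commutator is the copy of
  \<open>flip_comm 2 m\<close> at the letter 0, which lies in \<open>KB m\<close> by regular
  branching.\<close>

lemma flip_comm_1_commutator:
  assumes m: "m \<ge> 2" and g: "g \<in> GB m"
  shows "g \<circ> flip_comm 1 m \<circ> inv\<^bsub>AutX\<^esub> g \<circ> inv\<^bsub>AutX\<^esub> (flip_comm 1 m) \<in> KB m"
proof -
  let ?z = "flip_comm 1 m"
  have z: "inv\<^bsub>AutX\<^esub> ?z = ?z"
    by (intro inv_involution flip_comm_aut flip_comm_1_invol m)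
  have "g \<otimes>\<^bsub>AutX\<^esub> ?z \<otimes>\<^bsub>AutX\<^esub> inv\<^bsub>AutX\<^esub> g \<otimes>\<^bsub>AutX\<^esub> inv\<^bsub>AutX\<^esub> ?z \<in> KB m"
  proof (rule AutX.commutator_generate[OF _ subgroup_KB])
    show "GB_gens m \<subseteq> carrier AutX" "?z \<in> carrier AutX" "g \<in> generate AutX (GB_gens m)"
      using GB_gens_aut flip_comm_aut g by (auto simp: GB_def)
    show "g \<otimes>\<^bsub>AutX\<^esub> x \<otimes>\<^bsub>AutX\<^esub> inv\<^bsub>AutX\<^esub> g \<in> KB m"
      if "g \<in> generate AutX (GB_gens m)" "x \<in> KB m" for g x
      using KB_conj[of g m x] that by (simp only: AutX_simps GB_def)
    fix s assume s: "s \<in> GB_gens m"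
    have "s \<circ> ?z \<circ> s \<circ> ?z \<in> KB m \<and> inv\<^bsub>AutX\<^esub> s = s"
    proof (cases "s = flip")
      case True
      have "(s \<circ> ?z \<circ> s \<circ> ?z) u = id u" for u
        using True m by (cases u) (simp_all add: flip_comm_1[OF m, unfolded One_nat_def], simp add: flip_comm_def)
      then have "s \<circ> ?z \<circ> s \<circ> ?z = id" by blast
      then show ?thesis using True subgroupD(2)[OF subgroup_KB] inv_flip by simp
    next
      case False
      then obtain i where i: "s = gen_b i m" "1 \<le> i" "i \<le> m" using s by (auto simp: GB_gens_def)
      show ?thesis
      proof (cases "i = m")
        case True
        have "(s \<circ> ?z \<circ> s \<circ> ?z) u = graft [False] (flip_comm 2 m) u" for u
        proof (cases u)
          case Nil
          then show ?thesis using i by (simp add: flip_comm_def graft_def)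
        next
          case (Cons x w)
          then show ?thesis
            using i True gen_b_commute[of 1 m 2 w]
            by (cases x) (simp_all add: flip_comm_1[OF m, unfolded One_nat_def] flip_comm_def[of 2] graft_def)
        qed
        then have "s \<circ> ?z \<circ> s \<circ> ?z = graft [False] (flip_comm 2 m)" by blast
        then show ?thesis using KB_graft[OF m flip_comm_KB, of 2] m i inv_gen_b by simp
      next
        case False
        have "(s \<circ> ?z \<circ> s \<circ> ?z) u = id u" for u
        proof (cases u)
          case Nil
          then show ?thesis using i by (simp add: flip_comm_def)
        next
          case (Cons x w)
          then show ?thesis
            using i False gen_b_commute[of "Suc i" m 2 w] by (cases x) (simp_all add: flip_comm_1[OF m, unfolded One_nat_def])
        qed
        then have "s \<circ> ?z \<circ> s \<circ> ?z = id" by blast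
        then show ?thesis using i subgroupD(2)[OF subgroup_KB] inv_gen_b by simp
      qed
    qed
    then show "s \<otimes>\<^bsub>AutX\<^esub> ?z \<otimes>\<^bsub>AutX\<^esub> inv\<^bsub>AutX\<^esub> s \<otimes>\<^bsub>AutX\<^esub> inv\<^bsub>AutX\<^esub> ?z \<in> KB m"
      unfolding AutX_simps z by metis
  qed
  then show ?thesis by (simp only: AutX_simps)
qed

lemma subgroup_KB1:
  assumes "m \<ge> 2"
  shows "subgroup (KB1 m) AutX"
proof -
  have "flip_comm 1 m \<circ> flip_comm 1 m = id" by (simp only: fun_eq_iff comp_apply flip_comm_1_invol[OF assms] id_apply) simp
  moreover have "flip_comm 1 m \<in> GB m" using assms by (intro flip_comm_GB) simp
  ultimately show ?thesis
    using AutX.adjoin_square_root[OF subgroup_KB, of "flip_comm 1 m" m] flip_comm_aut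
      subgroupD(2)[OF subgroup_KB] KB_conj
    unfolding KB1_def by (simp only: AutX_simps)
qed

lemma KB1_conj:
  assumes m: "m \<ge> 2" and g: "g \<in> GB m" and x: "x \<in> KB1 m"
  shows "g \<circ> x \<circ> inv\<^bsub>AutX\<^esub> g \<in> KB1 m"
proof -
  let ?z = "flip_comm 1 m"
  note G = subgroupD(1)[OF subgroup_GB]
  from x consider "x \<in> KB m" | y where "y \<in> KB m" "x = y \<circ> ?z" unfolding KB1_def by blast
  then show ?thesis
  proof cases
    case 1
    then show ?thesis using KB_conj[OF g] by (simp add: KB1_def)
  next
    case 2
    let ?y = "(g \<circ> y \<circ> inv\<^bsub>AutX\<^esub> g) \<circ> (g \<circ> ?z \<circ> inv\<^bsub>AutX\<^esub> g \<circ> inv\<^bsub>AutX\<^esub> ?z)"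
    have "?y \<in> KB m"
      by (intro subgroupD(3)[OF subgroup_KB] KB_conj[OF g 2(1)] flip_comm_1_commutator[OF m g])
    moreover have "g \<circ> x \<circ> inv\<^bsub>AutX\<^esub> g = ?y \<circ> ?z"
      using G[OF g] flip_comm_aut[of 1 m] 2(2) by (simp add: fun_eq_iff)
    ultimately show ?thesis unfolding KB1_def by blast
  qed
qed

text \<open>Among the generators, \<open>flip\<close> commutes with \<open>gen_b i m\<close> up to
  \<open>flip_comm i m\<close>, an element of \<open>KB1 m\<close>, and the \<open>gen_b i m\<close>
  commute with each other.\<close>

lemma derived_GB_subset_KB1:
  assumes m: "m \<ge> 2"
  shows "derived AutX (GB m) \<subseteq> KB1 m"
  unfolding GB_def
proof (rule AutX.derived_generate_subset[OF _ subgroup_KB1[OF m]])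
  note K1 = subgroupD[OF subgroup_KB1[OF m]]
  show "GB_gens m \<subseteq> carrier AutX" using GB_gens_aut by simp
  show "g \<otimes>\<^bsub>AutX\<^esub> x \<otimes>\<^bsub>AutX\<^esub> inv\<^bsub>AutX\<^esub> g \<in> KB1 m"
    if "g \<in> generate AutX (GB_gens m)" "x \<in> KB1 m" for g x
    using KB1_conj[OF m, of g x] that by (simp only: AutX_simps GB_def)
  have c: "flip_comm i m \<in> KB1 m" if i: "i \<in> {1..m}" for i
  proof (cases "i = 1")
    case True
    have "id \<circ> flip_comm 1 m \<in> KB1 m"
      unfolding KB1_def using subgroupD(2)[OF subgroup_KB[of m]] by blast
    then show ?thesis using True by simp
  next
    case False
    then show ?thesis using i flip_comm_KB[of i m] by (simp add: KB1_def)
  qed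
  have c': "gen_b i m \<circ> flip \<circ> gen_b i m \<circ> flip \<in> KB1 m" if i: "i \<in> {1..m}" for i
  proof -
    have "inv\<^bsub>AutX\<^esub> (flip_comm i m) = gen_b i m \<circ> flip \<circ> gen_b i m \<circ> flip"
      by (rule tree_aut_inv_eqI)
        (intro tree_aut_comp flip_aut gen_b_aut flip_comm_aut, rule flip_comm_aut, simp add: flip_comm_def)
    then show ?thesis using K1(4)[OF c[OF i]] by simp
  qed
  fix s t assume "s \<in> GB_gens m" "t \<in> GB_gens m"
  then have s: "s = flip \<or> (\<exists>i\<in>{1..m}. s = gen_b i m)" and t: "t = flip \<or> (\<exists>i\<in>{1..m}. t = gen_b i m)"
    by (auto simp: GB_gens_def)
  have "inv\<^bsub>AutX\<^esub> s = s" "inv\<^bsub>AutX\<^esub> t = t" using s t inv_flip inv_gen_b by metis+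
  moreover have "s \<circ> t \<circ> s \<circ> t \<in> KB1 m"
  proof -
    have id: "flip \<circ> flip \<circ> flip \<circ> flip = id" "gen_b i m \<circ> gen_b j m \<circ> gen_b i m \<circ> gen_b j m = id" for i j
      using gen_b_commute[of i m j] by (simp_all add: fun_eq_iff)
    from s t show ?thesis
      using id K1(2) c c' by (elim disjE bexE) (simp_all only: flip_comm_def)
  qed
  ultimately show "s \<otimes>\<^bsub>AutX\<^esub> t \<otimes>\<^bsub>AutX\<^esub> inv\<^bsub>AutX\<^esub> s \<otimes>\<^bsub>AutX\<^esub> inv\<^bsub>AutX\<^esub> t \<in> KB1 m"
    by (simp only: AutX_simps)
qed

text \<open>The generators are adjoined one at a time; each is an involution, so each at most
  doubles the count.\<close>

lemma GB_gens_chain: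
  assumes m: "m \<ge> 2" and "finite A" "A \<subseteq> GB_gens m"
  shows "\<exists>S. subgroup S AutX \<and> KB1 m \<subseteq> S \<and> S \<subseteq> GB m \<and> A \<subseteq> S \<and> act_count S k \<le> 2 ^ card A * act_count (KB1 m) k"
  using assms(2,3)
proof (induction A)
  case empty
  have "flip_comm 1 m \<in> GB m" using m by (intro flip_comm_GB) simp
  then have "KB1 m \<subseteq> GB m"
    unfolding KB1_def using KB_subset_GB[of m] subgroupD(3)[OF subgroup_GB[of m]] by blast
  then show ?case using subgroup_KB1[OF m] by auto
next
  case (insert x A)
  then obtain S where S: "subgroup S AutX" "KB1 m \<subseteq> S" "S \<subseteq> GB m" "A \<subseteq> S"
    "act_count S k \<le> 2 ^ card A * act_count (KB1 m) k" by auto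
  note G = subgroupD[OF subgroup_GB[of m]]
  have xG: "x \<in> GB m" using insert.prems unfolding GB_def by (auto intro: generate.incl)
  have xx: "x \<circ> x = id" using insert.prems by (auto simp: GB_gens_def fun_eq_iff)
  \<comment> \<open>Normalisation is automatic, since \<open>S\<close> contains the derived subgroup
    of \<open>GB m\<close>.\<close>
  have conj: "x \<circ> y \<circ> inv\<^bsub>AutX\<^esub> x \<in> S" if y: "y \<in> S" for y
  proof -
    have yG: "y \<in> GB m" using y S(3) by blast
    have "x \<circ> y \<circ> inv\<^bsub>AutX\<^esub> x \<circ> inv\<^bsub>AutX\<^esub> y \<in> derived_set AutX (GB m)"
      using xG yG by auto
    then have "x \<circ> y \<circ> inv\<^bsub>AutX\<^esub> x \<circ> inv\<^bsub>AutX\<^esub> y \<in> derived AutX (GB m)"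
      unfolding derived_def by (rule generate.incl)
    then have "x \<circ> y \<circ> inv\<^bsub>AutX\<^esub> x \<circ> inv\<^bsub>AutX\<^esub> y \<in> S" using derived_GB_subset_KB1[OF m] S(2) by blast
    then have "x \<circ> y \<circ> inv\<^bsub>AutX\<^esub> x \<circ> inv\<^bsub>AutX\<^esub> y \<circ> y \<in> S" using y by (rule subgroupD(3)[OF S(1)])
    moreover have "x \<circ> y \<circ> inv\<^bsub>AutX\<^esub> x \<circ> inv\<^bsub>AutX\<^esub> y \<circ> y = x \<circ> y \<circ> inv\<^bsub>AutX\<^esub> x"
      using G(1)[OF yG] by (simp add: fun_eq_iff)
    ultimately show ?thesis by simp
  qed
  let ?S = "S \<union> (\<lambda>y. y \<circ> x) ` S"
  have "subgroup ?S AutX"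
    using AutX.adjoin_square_root[OF S(1), of x] G(1)[OF xG] xx subgroupD(2)[OF S(1)] conj
    by (simp only: AutX_simps)
  moreover have "KB1 m \<subseteq> ?S" using S(2) by blast
  moreover have "?S \<subseteq> GB m" using S(3) G(3)[OF _ xG] by blast
  moreover have "insert x A \<subseteq> ?S"
  proof -
    have "id \<circ> x \<in> ?S" using subgroupD(2)[OF S(1)] by blast
    then show ?thesis using S(4) by auto
  qed
  moreover have "act_count ?S k \<le> 2 ^ card (insert x A) * act_count (KB1 m) k"
  proof -
    have "act_count ?S k \<le> 2 * act_count S k"
      using subgroupD(1)[OF S(1)] G(1)[OF xG] by (intro act_count_Un_coset) auto
    also have "\<dots> \<le> 2 * (2 ^ card A * act_count (KB1 m) k)" using S(5) by simp
    finally show ?thesis using insert.hyps by simp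
  qed
  ultimately show ?case by blast
qed

text \<open>At most \<open>m + 1\<close> factors of 2 come from the generators, and one more from
  \<open>KB1 m\<close> over \<open>KB m\<close>.\<close>

lemma act_count_GB_le:
  assumes m: "m \<ge> 2"
  shows "act_count (GB m) k \<le> 2 ^ (m + 2) * act_count (KB m) k"
proof -
  have fin: "finite (GB_gens m)" by (simp add: GB_gens_def)
  have "card (GB_gens m) \<le> Suc (card ((\<lambda>i. gen_b i m) ` {1..m}))"
    unfolding GB_gens_def by (simp add: card_insert_if)
  also have "card ((\<lambda>i. gen_b i m) ` {1..m}) \<le> m" using card_image_le[of "{1..m}"] by simp
  finally have card: "card (GB_gens m) \<le> m + 1" by simp
  obtain S where S: "subgroup S AutX" "GB_gens m \<subseteq> S"
    "act_count S k \<le> 2 ^ card (GB_gens m) * act_count (KB1 m) k"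
    using GB_gens_chain[OF m fin subset_refl] by blast
  have "GB m \<subseteq> S" unfolding GB_def using S(2,1) by (rule AutX.generate_subgroup_incl)
  then have "act_count (GB m) k \<le> act_count S k"
    using subgroupD(1)[OF S(1)] by (intro act_count_mono) auto
  also note S(3)
  also have "2 ^ card (GB_gens m) * act_count (KB1 m) k \<le> 2 ^ (m + 1) * (2 * act_count (KB m) k)"
  proof (rule mult_le_mono)
    show "(2::nat) ^ card (GB_gens m) \<le> 2 ^ (m + 1)" using card by (intro power_increasing) simp_all
    show "act_count (KB1 m) k \<le> 2 * act_count (KB m) k"
      unfolding KB1_def using subgroupD(1)[OF subgroup_KB] flip_comm_aut
      by (intro act_count_Un_coset) auto
  qed
  finally show ?thesis by (simp add: mult_ac)
qed

section \<open>Full action on the first levels\<close>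

lemma tree_aut_transitive:
  "length u = length v \<Longrightarrow> \<exists>f\<in>tree_aut. f u = v"
proof (induction u v rule: list_induct2)
  case Nil
  then show ?case using tree_aut_id by (intro bexI[of _ id]) simp_all
next
  case (Cons x u y v)
  then obtain f where f: "f \<in> tree_aut" "f u = v" by blast
  define \<tau> where "\<tau> = (if x = y then id else Not)"
  have "bij (if c then id else Not)" for c using bij_Not by (cases c) simp_all
  then have "bij \<tau>" unfolding \<tau>_def .
  then have "node f f \<tau> \<in> tree_aut" using f(1) by (intro tree_aut_node)
  moreover have "\<tau> x = y" by (simp add: \<tau>_def)
  then have "node f f \<tau> (x # u) = y # v" using f(2) by simp
  ultimately show ?case by blast
qed

lemma words_Suc: "u \<in> words (Suc r) \<longleftrightarrow> (\<exists>v\<in>words r. \<exists>x. u = v @ [x])"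
  by (cases u rule: rev_cases) (simp_all add: words_def)

text \<open>Full action on a level includes transitivity, so the given flip can be conjugated to
  every vertex of that level. Products of these conjugates give every pattern of swaps on the next
  level.\<close>

lemma full_on_level:
  assumes G: "subgroup G AutX"
    and flips: "\<And>l. l < r \<Longrightarrow> \<exists>v\<in>words l. \<exists>g\<in>G. \<forall>u\<in>words (Suc l). g u = graft v flip u"
    and f: "f \<in> tree_aut"
  shows "\<exists>g\<in>G. \<forall>u\<in>words r. g u = f u"
  using flips f
proof (induction r arbitrary: f)
  case 0
  then show ?case using subgroupD(2)[OF G] by (intro bexI[of _ id]) (auto simp: words_def tree_aut_Nil)
next
  case (Suc r)
  note GD = subgroupD[OF G]
  have IH: "\<exists>g\<in>G. \<forall>u\<in>words r. g u = h u" if "h \<in> tree_aut" for h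
    using Suc.IH[OF _ that] Suc.prems(1) less_SucI by blast
  obtain v0 g0 where v0: "v0 \<in> words r" and g0: "g0 \<in> G"
    and g0_flip: "\<And>u. u \<in> words (Suc r) \<Longrightarrow> g0 u = graft v0 flip u"
    using Suc.prems(1)[of r] by blast
  \<comment> \<open>The letter \<open>x \<noteq> (u = v)\<close> is an exclusive or: only the two
    children of \<open>v\<close> are exchanged.\<close>
  have single: "\<exists>g\<in>G. \<forall>u\<in>words r. \<forall>x. g (u @ [x]) = u @ [x \<noteq> (u = v)]" if v: "v \<in> words r" for v
  proof -
    have "length v0 = length v" using v v0 by (simp add: words_def)
    then obtain h where h: "h \<in> tree_aut" "h v0 = v" using tree_aut_transitive by blast
    obtain t where t: "t \<in> G" "t v0 = v" using IH[OF h(1)] h(2) v0 by auto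
    note ta = GD(1)[OF t(1)]
    have "(t \<circ> g0 \<circ> inv\<^bsub>AutX\<^esub> t) (u @ [x]) = u @ [x \<noteq> (u = v)]" if u: "u \<in> words r" for u x
    proof -
      define w where "w = (inv\<^bsub>AutX\<^esub> t) u"
      have tw: "t w = u" using ta by (simp add: w_def)
      obtain y where y: "(inv\<^bsub>AutX\<^esub> t) (u @ [x]) = w @ [y]"
        using tree_aut_snoc[OF tree_aut_inverse(1)[OF ta], of u x] by (auto simp: w_def)
      have twy: "t (w @ [y]) = u @ [x]" unfolding y[symmetric] using ta by simp
      have w: "w \<in> words r" using u ta by (simp add: w_def tree_aut_words)
      have wy: "w @ [y] \<in> words (Suc r)" using w by (simp add: words_def)
      show ?thesis
      proof (cases "u = v")
        case True
        then have wv: "w = v0" using tw t(2) tree_aut_inj[OF ta] by metis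
        then have "g0 (w @ [y]) = w @ [\<not> y]" using g0_flip[OF wy] by (simp add: graft_def)
        moreover obtain x' where x': "t (w @ [\<not> y]) = u @ [x']"
          using tree_aut_snoc[OF ta, of w "\<not> y"] tw by auto
        moreover have "x' = (\<not> x)"
        proof -
          have "t (w @ [\<not> y]) \<noteq> t (w @ [y])" using tree_aut_inj[OF ta] by simp
          then show ?thesis unfolding x' twy by simp
        qed
        ultimately show ?thesis using y True by simp
      next
        case False
        then have "w \<noteq> v0" using tw t(2) by metis
        then have "\<not> prefix v0 (w @ [y])" using w v0 by (auto simp: words_def prefix_def append_eq_append_conv)
        then have "g0 (w @ [y]) = w @ [y]" using g0_flip[OF wy] by (simp add: graft_def)
        then show ?thesis using y twy False by simp
      qed
    qed
    moreover have "t \<circ> g0 \<circ> inv\<^bsub>AutX\<^esub> t \<in> G" by (intro GD t g0)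
    ultimately show ?thesis by blast
  qed
  have flip_set: "\<exists>g\<in>G. \<forall>u\<in>words r. \<forall>x. g (u @ [x]) = u @ [x \<noteq> (u \<in> A)]"
    if "finite A" "A \<subseteq> words r" for A
    using that
  proof (induction A)
    case empty
    then show ?case using GD(2) by (intro bexI[of _ id]) simp_all
  next
    case (insert v A)
    then obtain g where g: "g \<in> G" "\<And>u x. u \<in> words r \<Longrightarrow> g (u @ [x]) = u @ [x \<noteq> (u \<in> A)]" by auto
    obtain h where h: "h \<in> G" "\<And>u x. u \<in> words r \<Longrightarrow> h (u @ [x]) = u @ [x \<noteq> (u = v)]"
      using single[of v] insert.prems by auto
    have "(h \<circ> g) (u @ [x]) = u @ [x \<noteq> (u \<in> insert v A)]" if "u \<in> words r" for u x
      using that insert.hyps(2) g(2) h(2) by auto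
    then show ?case using GD(3)[OF h(1) g(1)] by blast
  qed
  obtain g where g: "g \<in> G" "\<And>u. u \<in> words r \<Longrightarrow> g u = f u" using IH[OF Suc.prems(2)] by blast
  note ga = GD(1)[OF g(1)]
  \<comment> \<open>The element \<open>g\<close> realises \<open>f\<close> on level
    \<open>r\<close>; the remaining error \<open>?k\<close> fixes that level and is the pattern of
    swaps at the vertices in \<open>A\<close>.\<close>
  let ?k = "inv\<^bsub>AutX\<^esub> g \<circ> f"
  have ka: "?k \<in> tree_aut" by (intro tree_aut_comp tree_aut_inverse(1) ga Suc.prems(2))
  have k: "?k u = u" if "u \<in> words r" for u
    using g(2)[OF that, symmetric] ga by simp
  define A where "A = {u \<in> words r. ?k (u @ [False]) = u @ [True]}"
  have kA: "?k (u @ [x]) = u @ [x \<noteq> (u \<in> A)]" if u: "u \<in> words r" for u x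
  proof -
    obtain y0 y1 where y: "?k (u @ [False]) = u @ [y0]" "?k (u @ [True]) = u @ [y1]"
      using tree_aut_snoc[OF ka, of u] k[OF u] by metis
    have "?k (u @ [False]) \<noteq> ?k (u @ [True])" using tree_aut_inj[OF ka] by simp
    then have "y1 = (\<not> y0)" unfolding y by auto
    moreover have "u \<in> A \<longleftrightarrow> y0" unfolding A_def using u y(1) by simp
    ultimately show ?thesis using y by (cases x) simp_all
  qed
  have "finite A"
    unfolding A_def by (rule finite_subset[OF Collect_restrict finite_words])
  moreover have "A \<subseteq> words r"
    unfolding A_def by (rule Collect_restrict)
  ultimately have "\<exists>e\<in>G. \<forall>u\<in>words r. \<forall>x. e (u @ [x]) = u @ [x \<noteq> (u \<in> A)]"
    by (rule flip_set)
  then obtain e where e: "e \<in> G" "\<forall>u\<in>words r. \<forall>x. e (u @ [x]) = u @ [x \<noteq> (u \<in> A)]" ..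
  have "(g \<circ> e) u = f u" if u: "u \<in> words (Suc r)" for u
  proof -
    obtain v x where v: "v \<in> words r" "u = v @ [x]" using u unfolding words_Suc by blast
    have "e u = ?k u" unfolding v(2) kA[OF v(1)] by (rule e(2)[THEN bspec, OF v(1), THEN spec])
    then have "g (e u) = g (?k u)" by (rule arg_cong)
    also have "\<dots> = f u" using ga by simp
    finally show ?thesis by simp
  qed
  then show ?case using GD(3)[OF g(1) e(1)] by blast
qed

lemma gen_b_Nil_singleton: "gen_b i m [x] = [x]"
  by (cases x) simp_all

text \<open>Along the first \<open>l\<close> ones the index rises from \<open>m - l\<close> to
  \<open>m\<close>, where the letter 0 triggers \<open>flip\<close>. The word then has one letter
  left, and in the branch of the letter 1 that letter is fixed.\<close>

lemma gen_b_level: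
  assumes "l < m" "u \<in> words (l + 2)"
  shows "gen_b (m - l) m u = graft (replicate l True @ [False]) flip u"
  using assms
proof (induction l arbitrary: u)
  case 0
  then obtain x y where "u = [x, y]" by (auto simp: words_def length_Suc_conv numeral_2_eq_2)
  then show ?case by (cases x) (simp_all add: gen_b_Nil_singleton graft_def)
next
  case (Suc l)
  then obtain x w where u: "u = x # w" "w \<in> words (l + 2)" by (auto simp: words_def length_Suc_conv)
  show ?case
  proof (cases x)
    case True
    have "Suc (m - Suc l) = m - l" using Suc.prems by simp
    then show ?thesis
      using True u Suc.IH[OF _ u(2)] Suc.prems by (simp add: graft_Cons)
  next
    case False
    then show ?thesis using u Suc.prems by (simp add: graft_Cons)
  qed
qed

text \<open>\<open>flip\<close> swaps at the root, and \<open>gen_b (m - k) m\<close> swaps at a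
  single vertex of level \<open>k + 1\<close> for each \<open>k < m\<close>; so levels 0 to
  \<open>m\<close> are all covered.\<close>

lemma act_count_GB: "act_count (GB m) (m + 1) = 2 ^ (2 ^ (m + 1) - 1)"
proof -
  have "\<exists>g\<in>GB m. \<forall>u\<in>words (m + 1). g u = f u" if "f \<in> tree_aut" for f
  proof (rule full_on_level[OF subgroup_GB _ that])
    fix l assume l: "l < m + 1"
    show "\<exists>v\<in>words l. \<exists>g\<in>GB m. \<forall>u\<in>words (Suc l). g u = graft v flip u"
    proof (cases l)
      case 0
      then show ?thesis using flip_GB by (auto simp: words_def graft_Nil)
    next
      case (Suc k)
      have "gen_b (m - k) m \<in> GB m" using l Suc by (intro gen_b_GB) auto
      moreover have "replicate k True @ [False] \<in> words l" using Suc by (simp add: words_def)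
      moreover have "gen_b (m - k) m u = graft (replicate k True @ [False]) flip u" if "u \<in> words (Suc l)" for u
        using that l Suc by (intro gen_b_level) auto
      ultimately show ?thesis by blast
    qed
  qed
  then have "(\<lambda>f. restrict f (words (m + 1))) ` tree_aut \<subseteq> (\<lambda>f. restrict f (words (m + 1))) ` GB m"
    unfolding image_subset_iff image_iff restrict_eq_iff by metis
  then have "act_count tree_aut (m + 1) \<le> act_count (GB m) (m + 1)"
    unfolding act_count_def using subgroupD(1)[OF subgroup_GB]
    by (intro card_mono finite_restrict_image) auto
  moreover have "act_count (GB m) (m + 1) \<le> act_count tree_aut (m + 1)"
    using subgroupD(1)[OF subgroup_GB] by (intro act_count_mono) auto
  ultimately show ?thesis by (simp add: act_count_tree_aut)
qed

section \<open>The Hausdorff dimension\<close>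

lemma derived_bt_args:
  assumes "n \<ge> 3" "length w = n" "x \<in> derived AutX (generate AutX (set (bt_args n (gen_bt (Suc n)))))"
  shows "graft w x \<in> derived AutX (H n)"
proof -
  let ?gs = "bt_args n (gen_bt (Suc n))"
  have len: "length ?gs = n" using assms(1) by (rule length_bt_args)
  have "graft w x \<in> derived AutX (generate AutX {gen_a (length ?gs), delta ?gs})"
    using assms len by (intro graft_derived_delta tree_aut_bt_args gen_bt_aut) auto
  then show ?thesis by (simp only: len H_def gen_bt_rec[of n, symmetric])
qed

lemma derived_generate_mono:
  assumes "A \<subseteq> B"
  shows "derived AutX (generate AutX A) \<subseteq> derived AutX (generate AutX B)"
  using assms by (intro AutX.mono_derived AutX.mono_generate)

lemma graft_derived_H:
  assumes "n \<ge> 3"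
  shows "\<exists>N. \<forall>w\<in>words N. \<forall>x\<in>derived AutX (H (n + k)). graft w x \<in> derived AutX (H n)"
proof (induction k)
  case 0
  show ?case by (intro exI[of _ 0]) (simp add: words_def graft_Nil)
next
  case (Suc k)
  then obtain N where N: "\<And>w x. w \<in> words N \<Longrightarrow> x \<in> derived AutX (H (n + k)) \<Longrightarrow> graft w x \<in> derived AutX (H n)"
    by blast
  \<comment> \<open>The generators of \<open>H (n + Suc k)\<close> are the last two arguments of
    \<open>delta\<close> in the recursion for \<open>gen_bt (n + k)\<close>, which sit
    \<open>n + k\<close> levels below.\<close>
  have sub: "derived AutX (H (n + Suc k)) \<subseteq> derived AutX (generate AutX (set (bt_args (n + k) (gen_bt (Suc (n + k))))))"
    unfolding H_def by (intro derived_generate_mono) (auto simp: bt_args_def)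
  have "graft w x \<in> derived AutX (H n)"
    if w: "w \<in> words (N + (n + k))" and x: "x \<in> derived AutX (H (n + Suc k))" for w x
  proof -
    have "graft (drop N w) x \<in> derived AutX (H (n + k))"
      using sub x w assms by (intro derived_bt_args) (auto simp: words_def)
    then have "graft (take N w) (graft (drop N w) x) \<in> derived AutX (H n)"
      using w by (intro N) (simp_all add: words_def)
    then show ?thesis by (simp add: graft_append[symmetric])
  qed
  then show ?case by blast
qed

lemma graft_KB_H:
  assumes n: "n \<ge> 3" and m: "m \<ge> 2" "m \<ge> n"
  shows "\<exists>N. \<forall>j\<ge>N. \<forall>w\<in>words j. \<forall>x\<in>KB m. graft w x \<in> H n"
proof -
  \<comment> \<open>At index \<open>m + 3\<close> the arguments of \<open>delta\<close> include
    \<open>a\<close> and all \<open>gen_b i m\<close>.\<close>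
  define k where "k = m + 3 - n"
  have k: "n + k = m + 3" using m by (simp add: k_def)
  have H: "H n \<subseteq> tree_aut" using subgroupD(1)[OF H_subgroup] by blast
  obtain N where N: "\<And>w x. w \<in> words N \<Longrightarrow> x \<in> derived AutX (H (m + 3)) \<Longrightarrow> graft w x \<in> derived AutX (H n)"
    using graft_derived_H[OF n, of k] unfolding k by blast
  have "GB_gens m \<subseteq> set (bt_args (m + 3) (gen_bt (Suc (m + 3))))"
    unfolding GB_gens_def bt_args_def gen_a_1 by auto
  then have KB: "KB m \<subseteq> derived AutX (generate AutX (set (bt_args (m + 3) (gen_bt (Suc (m + 3))))))"
    using KB_subset_derived[of m] derived_generate_mono unfolding GB_def by blast
  have "graft w x \<in> H n" if j: "j \<ge> N + (m + 3)" and w: "w \<in> words j" and x: "x \<in> KB m" for j w x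
  proof -
    \<comment> \<open>Here \<open>u\<close> leads from \<open>H n\<close> to
      \<open>H (m + 3)\<close>, \<open>v\<close> to the group of the arguments of
      \<open>delta\<close>, and the rest \<open>t\<close>, of arbitrary length, stays inside
      \<open>KB m\<close>. Hence every sufficiently deep level is reached.\<close>
    define u v t where "u = take N w" and "v = take (m + 3) (drop N w)" and "t = drop (m + 3) (drop N w)"
    have uvt: "w = u @ v @ t" by (simp only: u_def v_def t_def append_take_drop_id)
    have len: "u \<in> words N" "length v = m + 3" using j w by (simp_all add: u_def v_def words_def)
    have "graft t x \<in> KB m" using m(1) x by (rule KB_graft)
    then have "graft v (graft t x) \<in> derived AutX (H (m + 3))"
      using KB len(2) by (intro derived_bt_args) auto
    then have "graft u (graft v (graft t x)) \<in> derived AutX (H n)" by (rule N[OF len(1)])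
    then show ?thesis
      using AutX.derived_incl[OF subset_refl H_subgroup[of n]] unfolding uvt graft_append by blast
  qed
  then show ?thesis by blast
qed

section \<open>Bounds on the action counts of \<open>H n\<close>\<close>

lemma log_act_count_ge:
  assumes n: "n \<ge> 3" and m: "m \<ge> 2" "m \<ge> n"
  shows "\<forall>\<^sub>F M in sequentially. 1 - (real m + 3) / 2 ^ (m + 1) \<le> log 2 (act_count (H n) M) / 2 ^ M"
proof -
  have Haut: "H n \<subseteq> tree_aut" using subgroupD(1)[OF H_subgroup] by blast
  let ?q = "act_count (KB m) (m + 1)"
  obtain N where N: "\<And>j w x. j \<ge> N \<Longrightarrow> w \<in> words j \<Longrightarrow> x \<in> KB m \<Longrightarrow> graft w x \<in> H n"
    using graft_KB_H[OF assms] by blast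
  \<comment> \<open>On level \<open>m + 1\<close> the group \<open>GB m\<close> acts as the full
    automorphism group, so the index bound leaves at least
    \<open>2 ^ (2 ^ (m + 1) - (m + 3))\<close> actions for \<open>KB m\<close>.\<close>
  have "2 ^ (2 ^ (m + 1) - 1) \<le> 2 ^ (m + 2) * ?q"
    using act_count_GB_le[OF m(1), of "m + 1"] by (simp only: act_count_GB)
  then have "real (2 ^ (2 ^ (m + 1) - 1)) \<le> real (2 ^ (m + 2) * ?q)" by (rule of_nat_mono)
  then have q: "(2::real) ^ (2 ^ (m + 1) - 1) \<le> 2 ^ (m + 2) * real ?q" by simp
  have "(0::real) < 2 ^ (2 ^ (m + 1) - 1)" by simp
  then have "0 < 2 ^ (m + 2) * real ?q" using q by linarith
  then have q0: "real ?q > 0" by (simp add: zero_less_mult_iff)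
  have "real (2 ^ (m + 1) - 1) = log 2 (2 ^ (2 ^ (m + 1) - 1))" by simp
  also have "\<dots> \<le> log 2 (2 ^ (m + 2) * real ?q)" using q by (intro log_mono) simp_all
  also have "\<dots> = real (m + 2) + log 2 ?q" using q0 by (subst log_mult_pos) (simp_all only: log_nat_power, simp_all)
  finally have logq: "2 ^ (m + 1) - real (m + 3) \<le> log 2 ?q"
    by (simp add: of_nat_diff)
  have "1 - (real m + 3) / 2 ^ (m + 1) \<le> log 2 (act_count (H n) M) / 2 ^ M" if M: "M \<ge> N + (m + 1)" for M
  proof -
    \<comment> \<open>Every large level lies \<open>m + 1\<close> levels below some level
      \<open>j \<ge> N\<close>. The counts for the copies of \<open>KB m\<close> at its
      \<open>2 ^ j\<close> vertices multiply, and the normalised bound no longer depends on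
      \<open>j\<close>.\<close>
    define j where "j = M - (m + 1)"
    have j: "j \<ge> N" "M = j + (m + 1)" using M by (simp_all add: j_def)
    have "?q ^ (2 ^ j) \<le> act_count (H n) M"
      unfolding j(2) using Haut subgroupD(1)[OF subgroup_KB] subgroupD(3)[OF H_subgroup] N[OF j(1)]
      by (intro act_count_graft) auto
    then have le: "real ?q ^ (2 ^ j) \<le> real (act_count (H n) M)"
      using of_nat_mono[where 'a = real] by (metis of_nat_power)
    have "2 ^ j * log 2 ?q = log 2 (real ?q ^ (2 ^ j))" using q0 by (simp add: log_nat_power)
    also have "\<dots> \<le> log 2 (act_count (H n) M)" using le q0 by (intro log_mono) simp_all
    finally have "2 ^ j * log 2 ?q \<le> log 2 (act_count (H n) M)" .
    moreover have "2 ^ j * (2 ^ (m + 1) - real (m + 3)) \<le> 2 ^ j * log 2 ?q"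
      using logq by (intro mult_left_mono) simp_all
    ultimately have "2 ^ j * (2 ^ (m + 1) - real (m + 3)) \<le> log 2 (act_count (H n) M)" by linarith
    then have "2 ^ j * (2 ^ (m + 1) - real (m + 3)) / 2 ^ M \<le> log 2 (act_count (H n) M) / 2 ^ M"
      by (intro divide_right_mono) simp_all
    moreover have "2 ^ j * (2 ^ (m + 1) - real (m + 3)) / 2 ^ M = 1 - (real m + 3) / 2 ^ (m + 1)"
      unfolding j(2) power_add[of 2 j] by (simp add: diff_divide_distrib)
    ultimately show ?thesis by simp
  qed
  then show ?thesis by (auto simp: eventually_sequentially)
qed

lemma log_act_count_le:
  assumes "S \<subseteq> tree_aut" "S \<noteq> {}"
  shows "log 2 (act_count S M) / 2 ^ M \<le> 1"
proof -
  have "act_count S M > 0"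
    unfolding act_count_def using finite_restrict_image[OF assms(1)] assms(2) by (simp add: card_gt_0_iff)
  moreover have "real (act_count S M) \<le> 2 ^ (2 ^ M)"
  proof -
    have "act_count S M \<le> 2 ^ (2 ^ M - 1)"
      using act_count_mono[OF assms(1) subset_refl] by (simp only: act_count_tree_aut)
    also have "\<dots> \<le> 2 ^ (2 ^ M)" by (intro power_increasing) simp_all
    finally have "real (act_count S M) \<le> real (2 ^ (2 ^ M))" by (rule of_nat_mono)
    then show ?thesis by simp
  qed
  ultimately have "log 2 (act_count S M) \<le> log 2 (2 ^ (2 ^ M))" by (intro log_mono) simp_all
  then show ?thesis by simp
qed

theorem theorem6p5:
  fixes n :: nat
  assumes "n \<ge> 3"
  shows "hausdorff_dim (H n) = 1"
proof (rule antisym)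
  let ?x = "\<lambda>M. ereal (log 2 (act_count (H n) M) / 2 ^ M)"
  have dim: "hausdorff_dim (H n) = liminf ?x"
    unfolding hausdorff_dim_def order_mod_level[OF H_subgroup] ..
  have "H n \<subseteq> tree_aut" "H n \<noteq> {}" using subgroupD(1,2)[OF H_subgroup] by blast+
  then have "?x M \<le> 1" for M using log_act_count_le by simp
  then have "limsup ?x \<le> 1" by (intro Limsup_bounded) simp
  then show "hausdorff_dim (H n) \<le> 1"
    unfolding dim using Liminf_le_Limsup[of sequentially ?x] by simp
  \<comment> \<open>For fixed \<open>m\<close> the bound holds on all large levels and so passes to
    the limit inferior; afterwards \<open>m\<close> tends to infinity.\<close>
  have lower: "ereal (1 - (real m + 3) / 2 ^ (m + 1)) \<le> liminf ?x" if "m \<ge> n" for m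
    using log_act_count_ge[OF assms, of m] that assms by (intro Liminf_bounded) simp_all
  have "(\<lambda>m. real m * (1/2) ^ m) \<longlonglongrightarrow> 0" "(\<lambda>m. (1/2::real) ^ m) \<longlonglongrightarrow> 0"
    using powser_times_n_limit_0[of "1/2::real"] by (simp_all add: LIMSEQ_power_zero)
  then have "(\<lambda>m. 1 - (real m * (1/2) ^ m * (1/2) + 3/2 * (1/2) ^ m)) \<longlonglongrightarrow> 1 - (0 * (1/2) + 3/2 * 0)"
    by (intro tendsto_diff tendsto_add tendsto_mult tendsto_const)
  moreover have "1 - (real m * (1/2) ^ m * (1/2) + 3/2 * (1/2) ^ m) = 1 - (real m + 3) / 2 ^ (m + 1)" for m
    by (simp add: field_simps)
  ultimately have "(\<lambda>m. 1 - (real m + 3) / 2 ^ (m + 1)) \<longlonglongrightarrow> 1"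
    by (simp only: mult_zero_left mult_zero_right add_0_left diff_zero)
  then have "(\<lambda>m. ereal (1 - (real m + 3) / 2 ^ (m + 1))) \<longlonglongrightarrow> ereal 1" by (rule tendsto_ereal)
  then have "ereal 1 \<le> liminf ?x"
    by (rule LIMSEQ_le_const2) (use lower in blast)
  then show "1 \<le> hausdorff_dim (H n)" unfolding dim by (simp only: one_ereal_def)
qed

end
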